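(* Let $\Omega_0$ be a domain in $\mathbb{R}^{p+1}$ and $f_0\in C^{\omega}(\Omega_0,\mathbb{A})$ a real analytic function. Then the function $$CK[f_0](\mathbf{x})=\sum_{k=0}^{\infty}\frac{r^{2k}}{(2k)!}(-\Delta_{\mathbf{x}_p})^kf_0(\mathbf{x}_p)+\underline{\omega}\sum_{k=0}^{\infty}\frac{r^{2k+1}}{(2k+1)!}(-\Delta_{\mathbf{x}_p})^k\big(D_{\mathbf{x}_p}f_0(\mathbf{x}_p)\big),\qquad \mathbf{x}=\mathbf{x}_p+r\underline{\omega},$$ is a left generalized partial-slice Cauchy–Kovalevskaya extension of $f_0$ in a p-symmetric slice domain $\Omega\subseteq\Omega_0^{*}$ with $\Omega_0\subset\Omega$; that is, the series converge on $\Omega$, $CK[f_0]$ is left generalized partial-slice monogenic of type $(p,q)$ on $\Omega$, and $CK[f_0](\mathbf{x}_p)=f_0(\mathbf{x}_p)$ for $\mathbf{x}_p\in\Omega_0$.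
   Context: Let $\mathbb{A}$ be a real alternative algebra (the associator $[a,b,c]=(ab)c-a(bc)$ is an alternating trilinear function) with unity $1$, of finite real dimension $d>1$, equipped with an anti-involution $a\mapsto a^c$ (real linear, $a^c=a$ for $a\in\mathbb{R}$, $(a^c)^c=a$, $(ab)^c=b^ca^c$). Let $t(x)=x+x^c$, $n(x)=xx^c$, $\mathbb{S}_{\mathbb{A}}=\{x\in\mathbb{A}: t(x)=0,\ n(x)=1\}$ (assumed nonempty) and $Q_{\mathbb{A}}=\mathbb{R}\cup\{x: t(x)\in\mathbb{R},\ n(x)\in\mathbb{R},\ 4n(x)>t(x)^2\}$. Let $M$ be a real subspace with $\mathbb{R}\subsetneq M\subseteq Q_{\mathbb{A}}$ having a basis $(v_0,v_1,\dots,v_m)$, $m\ge1$, $v_0=1$, $v_s\in\mathbb{S}_{\mathbb{A}}$ and $v_sv_t=-v_tv_s$ for distinct $s,t\ge1$; complete it to a real basis of $\mathbb{A}$ and use the associated Euclidean norm. Identify $x=\sum_{s=0}^m x_sv_s\in M$ with $(x_0,\dots,x_m)\in\mathbb{R}^{m+1}$; $\mathbb{A}$-valued functions are differentiated componentwise, and $C^\omega$ means componentwise real analytic. Fix $p\in\{0,\dots,m-1\}$ and $q=m-p$; write $\mathbf{x}=\mathbf{x}_p+\underline{\mathbf{x}}_q$ with $\mathbf{x}_p=\sum_{s=0}^p x_sv_s$ (identified with $\mathbb{R}^{p+1}$) and $\underline{\mathbf{x}}_q=\sum_{s=p+1}^m x_sv_s$ (identified with $\mathbb{R}^q$). Let $\mathbb{S}=\{\sum_{s=p+1}^m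 x_sv_s:\sum x_s^2=1\}$; write $\underline{\mathbf{x}}_q=r\underline{\omega}$, $r=|\underline{\mathbf{x}}_q|\ge0$, $\underline{\omega}\in\mathbb{S}$. $D_{\mathbf{x}_p}f=\sum_{s=0}^p v_s\partial_{x_s}f$, $\Delta_{\mathbf{x}_p}=\sum_{s=0}^p\partial_{x_s}^2$. A function $f:\Omega\to\mathbb{A}$ ($\Omega\subseteq M$ open) is left generalized partial-slice monogenic of type $(p,q)$ if for every $\underline{\omega}\in\mathbb{S}$ its restriction to $\Omega_{\underline{\omega}}=\Omega\cap(\mathbb{R}^{p+1}\oplus\underline{\omega}\mathbb{R})$ is $C^1$ and $(D_{\mathbf{x}_p}+\underline{\omega}\partial_r)f(\mathbf{x}_p+r\underline{\omega})=0$ there. A domain $\Omega\subseteq M$ is a slice domain if $\Omega\cap\mathbb{R}^{p+1}\ne\emptyset$ and each $\Omega_{\underline{\omega}}$ is a domain in $\mathbb{R}^{p+2}$; it is p-symmetric if $\mathbf{x}_p+r\underline{\omega}\in\Omega$ with $r>0$ implies $\mathbf{x}_p+r\underline{\eta}\in\Omega$ for all $\underline{\eta}\in\mathbb{S}$. $\Omega_0^*=\{\mathbf{x}_p+\underline{\mathbf{x}}_q:\mathbf{x}_p\in\Omega_0,\ \underline{\mathbf{x}}_q\in\mathbb{R}^q\}$. *)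

theory Defs
  imports "HOL-Analysis.Analysis"
begin

text \<open>The algebra A is modelled as a Euclidean space type 'a whose inner product is the
Euclidean one associated with the chosen basis (so the basis vectors v 0..v m are
orthonormal); multiplication mul, unit one and anti-involution cj are explicit parameters,
since A need not be associative.\<close>

definition tr :: "('a \<Rightarrow> 'a) \<Rightarrow> 'a \<Rightarrow> 'a::real_vector" where
  "tr cj x = x + cj x"

definition nrm :: "('a \<Rightarrow> 'a \<Rightarrow> 'a) \<Rightarrow> ('a \<Rightarrow> 'a) \<Rightarrow> 'a \<Rightarrow> 'a::real_vector" where
  "nrm mul cj x = mul x (cj x)"

definition assoc3 :: "('a \<Rightarrow> 'a \<Rightarrow> 'a) \<Rightarrow> 'a \<Rightarrow> 'a \<Rightarrow> 'a \<Rightarrow> 'a::real_vector" where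
  "assoc3 mul a b c = mul (mul a b) c - mul a (mul b c)"

definition is_real :: "'a \<Rightarrow> 'a::real_vector \<Rightarrow> bool" where
  "is_real one a \<longleftrightarrow> (\<exists>c::real. a = c *\<^sub>R one)"

definition alt_algebra ::
  "('a \<Rightarrow> 'a \<Rightarrow> 'a) \<Rightarrow> 'a \<Rightarrow> ('a \<Rightarrow> 'a::real_vector) \<Rightarrow> bool" where
  "alt_algebra mul one cj \<longleftrightarrow>
     bilinear mul \<and>
     (\<forall>x. mul one x = x \<and> mul x one = x) \<and>
     (\<forall>a b. assoc3 mul a a b = 0 \<and> assoc3 mul a b a = 0 \<and> assoc3 mul b a a = 0) \<and>
     linear cj \<and> cj one = one \<and>
     (\<forall>a. cj (cj a) = a) \<and>
     (\<forall>a b. cj (mul a b) = mul (cj b) (cj a))"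

definition SA :: "('a \<Rightarrow> 'a \<Rightarrow> 'a) \<Rightarrow> 'a \<Rightarrow> ('a \<Rightarrow> 'a) \<Rightarrow> 'a::real_vector set" where
  "SA mul one cj = {x. tr cj x = 0 \<and> nrm mul cj x = one}"

definition QA :: "('a \<Rightarrow> 'a \<Rightarrow> 'a) \<Rightarrow> 'a \<Rightarrow> ('a \<Rightarrow> 'a) \<Rightarrow> 'a::real_vector set" where
  "QA mul one cj = {x. is_real one x} \<union>
     {x. \<exists>a b::real. tr cj x = a *\<^sub>R one \<and> nrm mul cj x = b *\<^sub>R one \<and> 4 * b > a\<^sup>2}"

definition basis_setup ::
  "('a \<Rightarrow> 'a \<Rightarrow> 'a) \<Rightarrow> 'a \<Rightarrow> ('a \<Rightarrow> 'a) \<Rightarrow> (nat \<Rightarrow> 'a::euclidean_space) \<Rightarrow> nat \<Rightarrow> bool" where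
  "basis_setup mul one cj v m \<longleftrightarrow>
     1 \<le> m \<and> v 0 = one \<and>
     (\<forall>s\<in>{1..m}. v s \<in> SA mul one cj) \<and>
     (\<forall>s\<in>{1..m}. \<forall>t\<in>{1..m}. s \<noteq> t \<longrightarrow> mul (v s) (v t) = - mul (v t) (v s)) \<and>
     (\<forall>s\<le>m. \<forall>t\<le>m. v s \<bullet> v t = (if s = t then 1 else 0)) \<and>
     span (v ` {0..m}) \<subseteq> QA mul one cj"

definition Mspace :: "(nat \<Rightarrow> 'a::euclidean_space) \<Rightarrow> nat \<Rightarrow> 'a set" where
  "Mspace v m = span (v ` {0..m})"

definition Mp :: "(nat \<Rightarrow> 'a::euclidean_space) \<Rightarrow> nat \<Rightarrow> 'a set" where
  "Mp v p = span (v ` {0..p})"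

definition Mq :: "(nat \<Rightarrow> 'a::euclidean_space) \<Rightarrow> nat \<Rightarrow> nat \<Rightarrow> 'a set" where
  "Mq v p m = span (v ` {p+1..m})"

definition xpart :: "(nat \<Rightarrow> 'a::euclidean_space) \<Rightarrow> nat \<Rightarrow> 'a \<Rightarrow> 'a" where
  "xpart v p x = (\<Sum>s\<le>p. (x \<bullet> v s) *\<^sub>R v s)"

definition xqpart :: "(nat \<Rightarrow> 'a::euclidean_space) \<Rightarrow> nat \<Rightarrow> nat \<Rightarrow> 'a \<Rightarrow> 'a" where
  "xqpart v p m x = (\<Sum>s\<in>{p+1..m}. (x \<bullet> v s) *\<^sub>R v s)"

definition Sph :: "(nat \<Rightarrow> 'a::euclidean_space) \<Rightarrow> nat \<Rightarrow> nat \<Rightarrow> 'a set" where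
  "Sph v p m = {w \<in> Mq v p m. norm w = 1}"

definition plane :: "(nat \<Rightarrow> 'a::euclidean_space) \<Rightarrow> nat \<Rightarrow> 'a \<Rightarrow> 'a set" where
  "plane v p w = {a + r *\<^sub>R w | a r. a \<in> Mp v p}"

definition slice :: "(nat \<Rightarrow> 'a::euclidean_space) \<Rightarrow> nat \<Rightarrow> 'a set \<Rightarrow> 'a \<Rightarrow> 'a set" where
  "slice v p \<Omega> w = \<Omega> \<inter> plane v p w"

definition dirderiv :: "('a::real_normed_vector \<Rightarrow> 'b::real_normed_vector) \<Rightarrow> 'a \<Rightarrow> 'a \<Rightarrow> 'b" where
  "dirderiv f u y = vector_derivative (\<lambda>t::real. f (y + t *\<^sub>R u)) (at 0)"

definition C1_on :: "'a set \<Rightarrow> ('a::euclidean_space \<Rightarrow> 'b::real_normed_vector) \<Rightarrow> bool" where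
  "C1_on S f \<longleftrightarrow> (\<exists>F :: 'a \<Rightarrow> ('a \<Rightarrow>\<^sub>L 'b). continuous_on S F \<and>
      (\<forall>y\<in>S. (f has_derivative blinfun_apply (F y)) (at y within S)))"

definition Dxp :: "('a \<Rightarrow> 'a \<Rightarrow> 'a) \<Rightarrow> (nat \<Rightarrow> 'a::euclidean_space) \<Rightarrow> nat \<Rightarrow> ('a \<Rightarrow> 'a) \<Rightarrow> 'a \<Rightarrow> 'a" where
  "Dxp mul v p f y = (\<Sum>s\<le>p. mul (v s) (dirderiv f (v s) y))"

definition Lapxp :: "(nat \<Rightarrow> 'a::euclidean_space) \<Rightarrow> nat \<Rightarrow> ('a \<Rightarrow> 'a) \<Rightarrow> 'a \<Rightarrow> 'a" where
  "Lapxp v p f y = (\<Sum>s\<le>p. dirderiv (\<lambda>z. dirderiv f (v s) z) (v s) y)"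

definition negLap_pow :: "(nat \<Rightarrow> 'a::euclidean_space) \<Rightarrow> nat \<Rightarrow> nat \<Rightarrow> ('a \<Rightarrow> 'a) \<Rightarrow> 'a \<Rightarrow> 'a" where
  "negLap_pow v p k f = ((\<lambda>g y. - Lapxp v p g y) ^^ k) f"

definition CK_even :: "(nat \<Rightarrow> 'a::euclidean_space) \<Rightarrow> nat \<Rightarrow> nat \<Rightarrow> ('a \<Rightarrow> 'a) \<Rightarrow> 'a \<Rightarrow> nat \<Rightarrow> 'a" where
  "CK_even v p m f0 x k =
     (norm (xqpart v p m x) ^ (2*k) / fact (2*k)) *\<^sub>R negLap_pow v p k f0 (xpart v p x)"

definition CK_odd :: "('a \<Rightarrow> 'a \<Rightarrow> 'a) \<Rightarrow> (nat \<Rightarrow> 'a::euclidean_space) \<Rightarrow> nat \<Rightarrow> nat \<Rightarrow> ('a \<Rightarrow> 'a) \<Rightarrow> 'a \<Rightarrow> nat \<Rightarrow> 'a" where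
  "CK_odd mul v p m f0 x k =
     (norm (xqpart v p m x) ^ (2*k+1) / fact (2*k+1)) *\<^sub>R negLap_pow v p k (Dxp mul v p f0) (xpart v p x)"

text \<open>omega = x_q / r (for r = 0 the odd part vanishes anyway).\<close>
definition CK :: "('a \<Rightarrow> 'a \<Rightarrow> 'a) \<Rightarrow> (nat \<Rightarrow> 'a::euclidean_space) \<Rightarrow> nat \<Rightarrow> nat \<Rightarrow> ('a \<Rightarrow> 'a) \<Rightarrow> 'a \<Rightarrow> 'a" where
  "CK mul v p m f0 x =
     (\<Sum>k. CK_even v p m f0 x k) +
     mul ((1 / norm (xqpart v p m x)) *\<^sub>R xqpart v p m x) (\<Sum>k. CK_odd mul v p m f0 x k)"

definition gps_monogenic ::
  "('a \<Rightarrow> 'a \<Rightarrow> 'a) \<Rightarrow> (nat \<Rightarrow> 'a::euclidean_space) \<Rightarrow> nat \<Rightarrow> nat \<Rightarrow> 'a set \<Rightarrow> ('a \<Rightarrow> 'a) \<Rightarrow> bool" where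
  "gps_monogenic mul v p m \<Omega> f \<longleftrightarrow>
     (\<forall>w\<in>Sph v p m. C1_on (slice v p \<Omega> w) f \<and>
        (\<forall>y\<in>slice v p \<Omega> w. Dxp mul v p f y + mul w (dirderiv f w y) = 0))"

definition domain_p :: "(nat \<Rightarrow> 'a::euclidean_space) \<Rightarrow> nat \<Rightarrow> 'a set \<Rightarrow> bool" where
  "domain_p v p \<Omega>0 \<longleftrightarrow> \<Omega>0 \<noteq> {} \<and> \<Omega>0 \<subseteq> Mp v p \<and>
     openin (top_of_set (Mp v p)) \<Omega>0 \<and> connected \<Omega>0"

definition slice_domain :: "(nat \<Rightarrow> 'a::euclidean_space) \<Rightarrow> nat \<Rightarrow> nat \<Rightarrow> 'a set \<Rightarrow> bool" where
  "slice_domain v p m \<Omega> \<longleftrightarrow>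
     \<Omega> \<subseteq> Mspace v m \<and> openin (top_of_set (Mspace v m)) \<Omega> \<and>
     \<Omega> \<inter> Mp v p \<noteq> {} \<and>
     (\<forall>w\<in>Sph v p m. slice v p \<Omega> w \<noteq> {} \<and>
        openin (top_of_set (plane v p w)) (slice v p \<Omega> w) \<and> connected (slice v p \<Omega> w))"

definition p_symmetric :: "(nat \<Rightarrow> 'a::euclidean_space) \<Rightarrow> nat \<Rightarrow> nat \<Rightarrow> 'a set \<Rightarrow> bool" where
  "p_symmetric v p m \<Omega> \<longleftrightarrow>
     (\<forall>a\<in>Mp v p. \<forall>r::real. \<forall>w\<in>Sph v p m. \<forall>e\<in>Sph v p m.
        r > 0 \<longrightarrow> a + r *\<^sub>R w \<in> \<Omega> \<longrightarrow> a + r *\<^sub>R e \<in> \<Omega>)"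

definition cyl_ext :: "(nat \<Rightarrow> 'a::euclidean_space) \<Rightarrow> nat \<Rightarrow> nat \<Rightarrow> 'a set \<Rightarrow> 'a set" where
  "cyl_ext v p m \<Omega>0 = {a + b | a b. a \<in> \<Omega>0 \<and> b \<in> Mq v p m}"

text \<open>Real analytic on Omega0 (subset of R^{p+1}): locally the sum of an (unconditionally,
equivalently absolutely) convergent power series in the coordinates x_0..x_p.\<close>
definition real_analytic_p :: "(nat \<Rightarrow> 'a::euclidean_space) \<Rightarrow> nat \<Rightarrow> 'a set \<Rightarrow> ('a \<Rightarrow> 'a) \<Rightarrow> bool" where
  "real_analytic_p v p \<Omega>0 f \<longleftrightarrow>
     (\<forall>a\<in>\<Omega>0. \<exists>\<delta>>0. \<exists>c :: (nat \<Rightarrow> nat) \<Rightarrow> 'a.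
        \<forall>h :: nat \<Rightarrow> real. (\<Sum>s\<le>p. (h s)\<^sup>2) < \<delta>\<^sup>2 \<longrightarrow>
          ((\<lambda>\<alpha>. (\<Prod>s\<le>p. h s ^ \<alpha> s) *\<^sub>R c \<alpha>) has_sum f (a + (\<Sum>s\<le>p. h s *\<^sub>R v s)))
            {\<alpha>. \<forall>s>p. \<alpha> s = 0})"

end

theory Submission
  imports Defs
begin

text \<open>
  For a fixed unit vector \<open>w\<close> orthogonal to \<open>x_p\<close>-space put \<open>T g = w (D g)\<close>. Since \<open>w (w z) = - z\<close>,
  monogenicity on the half-plane of \<open>w\<close> is the Cauchy--Kovalevskaya system \<open>\<partial>_r f = T f\<close>, with formal
  solution \<open>\<Sum>n. r^n / n! T^n f0\<close>. Alternativity and the symmetry of second derivatives give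
  \<open>T (T g) = - \<Delta> g\<close>, so the even and odd parts of this series are the two series of \<open>CK\<close>.
  For convergence, functions near \<open>a\<close> carry the norm \<open>\<Sum> |c_\<alpha>| \<rho>^|\<alpha>|\<close> of their Taylor series, for which
  each derivative costs \<open>1 / (\<rho> - \<sigma>)\<close> when the radius shrinks from \<open>\<rho>\<close> to \<open>\<sigma>\<close>; distributing a fixed
  loss of radius over \<open>n\<close> applications of \<open>T\<close> bounds \<open>T^n f0\<close> by \<open>N K^n n!\<close>. The constants do not
  depend on \<open>w\<close>, which makes the domain of convergence p-symmetric.
\<close>

section \<open>Series of functions\<close>

text \<open>Two mismatches shape the proof. \<open>dirderiv\<close>, \<open>Lapxp\<close> and
  \<open>CK\<close> act on functions on the whole algebra, whereas \<open>f0\<close> is controlled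
  only on \<Omega>0, which is open merely inside \<open>Mp v p\<close>. Functions are therefore
  composed with \<open>xpart v p\<close>, which gives them Frechet derivatives at ambient points,
  and identities between iterated operators are asserted only on \<Omega>0. A slice, moreover, is a
  full plane through the axis r = 0, where r is not smooth and the direction x_q / r jumps to its
  negative. The series is therefore written in the signed coordinate \<open>x \<bullet> w\<close>
  with \<open>w\<close> fixed. Replacing \<open>w\<close> by \<open>- w\<close> changes the sign of
  the coordinate and of T together, so each term is the same for both, and one series serves both
  half-planes. Lack of associativity is felt in products of left multiplications; polarized left
  alternativity gives these the Clifford relations. No gluing is required: \<open>CK\<close> is one
  global formula, so the local radii only have to be collected into a union of cylinders.\<close>

lemma has_derivative_suminf:
  fixes f :: "nat \<Rightarrow> 'a::real_normed_vector \<Rightarrow> 'b::banach" and f' :: "nat \<Rightarrow> 'a \<Rightarrow> 'a \<Rightarrow> 'b"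
  assumes "convex S" "open S" "x \<in> S"
    and deriv: "\<And>n y. y \<in> S \<Longrightarrow> (f n has_derivative f' n y) (at y)"
    and bound: "\<And>n y h. y \<in> S \<Longrightarrow> norm (f' n y h) \<le> M n * norm h"
    and M: "summable M" and "summable (\<lambda>n. f n x)"
  shows "((\<lambda>y. \<Sum>n. f n y) has_derivative (\<lambda>h. \<Sum>n. f' n x h)) (at x)"
proof -
  have summ: "summable (\<lambda>n. f' n y h)" if "y \<in> S" for y h
    by (rule summable_comparison_test'[where g="\<lambda>n. M n * norm h" and N=0])
       (use M bound that in \<open>auto intro: summable_mult2\<close>)
  have "\<exists>g. \<forall>y\<in>S. (\<lambda>n. f n y) sums g y \<and> (g has_derivative (\<lambda>h. \<Sum>n. f' n y h)) (at y within S)"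
  proof (rule has_derivative_series[OF \<open>convex S\<close>])
    fix e :: real assume "e > 0"
    \<comment> \<open>The tails of the majorant bound the error of the partial sums of the
      derivatives in operator norm, uniformly on \<open>S\<close>.\<close>
    have "(\<lambda>n. \<Sum>i. M (i + n)) \<longlonglongrightarrow> 0"
      using suminf_exist_split2[OF M] .
    then have "\<forall>\<^sub>F n in sequentially. (\<Sum>i. M (i + n)) < e"
      using \<open>e > 0\<close> by (rule order_tendstoD)
    then show "\<forall>\<^sub>F n in sequentially. \<forall>y\<in>S. \<forall>h.
        norm (sum (\<lambda>i. f' i y h) {..<n} - (\<Sum>n. f' n y h)) \<le> e * norm h"
    proof eventually_elim
      case (elim n)
      show ?case
      proof (intro ballI allI)
        fix y h :: 'a assume y: "y \<in> S"
        have Mn: "summable (\<lambda>i. M (i + n) * norm h)"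
          using M by (intro summable_mult2) (simp add: summable_iff_shift)
        have "norm (sum (\<lambda>i. f' i y h) {..<n} - (\<Sum>n. f' n y h)) = norm (\<Sum>i. f' (i + n) y h)"
          using suminf_split_initial_segment[OF summ[OF y], of h n] by simp
        also have "\<dots> \<le> (\<Sum>i. M (i + n) * norm h)"
          by (rule norm_suminf_le) (use bound y Mn in auto)
        also have "\<dots> = (\<Sum>i. M (i + n)) * norm h"
          using M by (intro suminf_mult2[symmetric]) (simp add: summable_iff_shift)
        also have "\<dots> \<le> e * norm h"
          using elim by (intro mult_right_mono) auto
        finally show "norm (sum (\<lambda>i. f' i y h) {..<n} - (\<Sum>n. f' n y h)) \<le> e * norm h" .
      qed
    qed
  qed (use assms in \<open>auto intro: has_derivative_at_withinI summable_sums\<close>)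
  then obtain g where g: "\<And>y. y \<in> S \<Longrightarrow> (\<lambda>n. f n y) sums g y"
    "\<And>y. y \<in> S \<Longrightarrow> (g has_derivative (\<lambda>h. \<Sum>n. f' n y h)) (at y within S)" by blast
  have "(g has_derivative (\<lambda>h. \<Sum>n. f' n x h)) (at x)"
    using g(2)[OF \<open>x \<in> S\<close>] at_within_open[OF \<open>x \<in> S\<close> \<open>open S\<close>] by simp
  then show ?thesis
    by (rule has_derivative_transform_within_open[OF _ \<open>open S\<close> \<open>x \<in> S\<close>])
       (use g(1) sums_unique in blast)
qed

text \<open>The quotient \<open>(\<rho> ^ k - \<sigma> ^ k) / (\<rho> - \<sigma>)\<close> is a sum
  of \<open>k\<close> products, each at least \<open>\<sigma> ^ (k - 1)\<close>. This plays the part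
  of Cauchy's estimate: the factor \<open>k\<close> of a derivative is paid for by radius.\<close>

lemma Cauchy_power_estimate:
  fixes \<sigma> \<rho> :: real
  assumes "0 \<le> \<sigma>" "\<sigma> < \<rho>" "0 < k"
  shows "of_nat k * \<sigma> ^ (k - 1) \<le> \<rho> ^ k / (\<rho> - \<sigma>)"
proof -
  have "(\<rho> - \<sigma>) * (of_nat k * \<sigma> ^ (k - 1)) \<le> (\<rho> - \<sigma>) * (\<Sum>i<k. \<sigma> ^ (k - Suc i) * \<rho> ^ i)"
  proof (intro mult_left_mono)
    have "of_nat k * \<sigma> ^ (k - 1) = (\<Sum>i<k. \<sigma> ^ (k - Suc i) * \<sigma> ^ i)"
      by (simp flip: power_add)
    also have "\<dots> \<le> (\<Sum>i<k. \<sigma> ^ (k - Suc i) * \<rho> ^ i)"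
      using assms by (intro sum_mono mult_left_mono power_mono) auto
    finally show "of_nat k * \<sigma> ^ (k - 1) \<le> (\<Sum>i<k. \<sigma> ^ (k - Suc i) * \<rho> ^ i)" .
  qed (use assms in auto)
  also have "\<dots> = \<rho> ^ k - \<sigma> ^ k"
    by (simp add: power_diff_sumr2 algebra_simps)
  also have "\<dots> \<le> \<rho> ^ k" using assms by simp
  finally show ?thesis using assms by (simp add: field_simps)
qed

text \<open>A single term of the exponential series at \<open>n\<close> is at most its sum.\<close>

lemma power_self_le_exp_fact: "real n ^ n \<le> exp 1 ^ n * fact n"
proof -
  have "real n ^ n / fact n \<le> (\<Sum>k. real n ^ k /\<^sub>R fact k)"
    using sum_le_suminf[of "\<lambda>k. real n ^ k /\<^sub>R fact k" "{n}"] summable_exp_generic[of "real n"]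
    by (simp add: field_simps)
  also have "\<dots> = exp 1 ^ n"
    using exp_of_nat_mult[where x="1::real"] by (metis exp_def mult.right_neutral)
  finally show ?thesis by (simp add: field_simps)
qed

lemma sums_interleave:
  fixes a b :: "nat \<Rightarrow> 'a::real_normed_vector"
  assumes "a sums x" "b sums y"
  shows "(\<lambda>n. if even n then a (n div 2) else b (n div 2)) sums (x + y)"
proof -
  have "(\<lambda>n. if even n then a (n div 2) else 0) sums x"
    by (rule sums_mono_reindex[of "\<lambda>n. 2 * n", THEN iffD1])
       (use assms(1) in \<open>auto simp: strict_mono_def elim!: evenE\<close>)
  moreover have "(\<lambda>n. if even n then 0 else b (n div 2)) sums y"
    by (rule sums_mono_reindex[of "\<lambda>n. 2 * n + 1", THEN iffD1])
       (use assms(2) in \<open>auto simp: strict_mono_def elim!: oddE\<close>)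
  ultimately have "(\<lambda>n. (if even n then a (n div 2) else 0) + (if even n then 0 else b (n div 2)))
      sums (x + y)"
    by (rule sums_add)
  then show ?thesis
    by (rule back_subst[of "\<lambda>f. f sums _"]) auto
qed

text \<open>Unconditionally convergent real series converge absolutely; in finite dimension this
  holds in each coordinate, and the sum of the coordinates' absolute values dominates the
  norm.\<close>

lemma summable_on_euclidean_imp_abs_summable:
  fixes f :: "'i \<Rightarrow> 'b::euclidean_space"
  assumes "f summable_on I"
  shows "(\<lambda>i. norm (f i)) summable_on I"
proof -
  have "(\<lambda>i. f i \<bullet> b) summable_on I" for b
    using summable_on_bounded_linear[OF bounded_linear_inner_left assms] by simp
  then have "(\<lambda>i. \<bar>f i \<bullet> b\<bar>) summable_on I" for b
    using summable_on_iff_abs_summable_on_real by fastforce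
  then have *: "(\<lambda>i. \<bar>f i \<bullet> b\<bar>) summable_on I" for b .
  have "(\<lambda>i. \<Sum>b\<in>S. \<bar>f i \<bullet> b\<bar>) summable_on I" if "finite S" for S
    using that by (induction S rule: finite_induct) (auto intro: summable_on_add *)
  then have "(\<lambda>i. \<Sum>b\<in>Basis. \<bar>f i \<bullet> b\<bar>) summable_on I"
    by simp
  then show ?thesis
    by (rule summable_on_comparison_test) (auto simp: norm_le_l1)
qed

text \<open>An enumeration of the multi-indices turns the unordered sum in
  \<open>real_analytic_p\<close> into an ordinary series.\<close>

lemma countably_infinite_exponents:
  obtains e :: "nat \<Rightarrow> nat \<Rightarrow> nat" where "bij_betw e UNIV {\<alpha>. \<forall>s>p. \<alpha> s = 0}"
proof -
  let ?I = "{\<alpha> :: nat \<Rightarrow> nat. \<forall>s>p. \<alpha> s = 0}"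
  have "inj_on (\<lambda>\<alpha>. map \<alpha> [0..<Suc p]) ?I"
  proof (rule inj_onI, rule ext)
    fix \<alpha> \<beta> :: "nat \<Rightarrow> nat" and s
    assume *: "\<alpha> \<in> ?I" "\<beta> \<in> ?I" and "map \<alpha> [0..<Suc p] = map \<beta> [0..<Suc p]"
    then have "\<forall>s\<le>p. \<alpha> s = \<beta> s"
      by (simp only: map_eq_conv) (auto simp: less_Suc_eq_le)
    then show "\<alpha> s = \<beta> s" using * by (cases "s \<le> p") auto
  qed
  then have "countable ?I" by (rule countableI')
  moreover have "infinite ?I"
  proof
    assume "finite ?I"
    then have "finite (range (\<lambda>(n::nat) (s::nat). if s = 0 then n else 0))"
      by (rule finite_subset[rotated]) auto
    moreover have "inj (\<lambda>(n::nat) (s::nat). if s = 0 then n else 0)"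
      by (rule injI) (metis (mono_tags))
    ultimately show False using finite_imageD infinite_UNIV_nat by blast
  qed
  ultimately show ?thesis using that bij_betw_from_nat_into by blast
qed

text \<open>Agreement is demanded only along the line through \<open>x\<close>: the functions
  compared later coincide on a subspace or a plane, in general on no open set of the
  algebra.\<close>

lemma dirderiv_cong:
  assumes "open U" "x \<in> U" "\<And>t. x + t *\<^sub>R u \<in> U \<Longrightarrow> f (x + t *\<^sub>R u) = g (x + t *\<^sub>R u)"
  shows "dirderiv f u x = dirderiv g u x"
  unfolding dirderiv_def
proof (rule vector_derivative_cong_eq)
  have "open ((\<lambda>t. x + t *\<^sub>R u) -` U)"
    by (intro open_vimage assms continuous_intros)
  then have "\<forall>\<^sub>F t in nhds 0. t \<in> (\<lambda>t. x + t *\<^sub>R u) -` U"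
    using assms(2) by (intro eventually_nhds_in_open) auto
  then show "\<forall>\<^sub>F t in nhds 0. t \<in> UNIV \<longrightarrow> f (x + t *\<^sub>R u) = g (x + t *\<^sub>R u)"
    by eventually_elim (use assms(3) in auto)
qed auto

lemma dirderiv_eq:
  assumes "(f has_derivative f') (at x)"
  shows "dirderiv f u x = f' u"
proof -
  have "((\<lambda>t. x + t *\<^sub>R u) has_derivative (\<lambda>t. t *\<^sub>R u)) (at (0::real))"
    by (auto intro!: derivative_eq_intros)
  then have "((\<lambda>t. f (x + t *\<^sub>R u)) has_derivative (\<lambda>t. f' (t *\<^sub>R u))) (at (0::real))"
    by (rule has_derivative_compose) (use assms in simp)
  then have "((\<lambda>t. f (x + t *\<^sub>R u)) has_vector_derivative f' u) (at 0)"
    using has_derivative_linear[OF assms] by (simp add: has_vector_derivative_def linear_cmul)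
  then show ?thesis unfolding dirderiv_def by (rule vector_derivative_at)
qed

section \<open>Power series in an orthonormal frame\<close>

locale orthonormal_frame =
  fixes v :: "nat \<Rightarrow> 'a::euclidean_space" and p :: nat
  assumes orthonormal: "s \<le> p \<Longrightarrow> t \<le> p \<Longrightarrow> v s \<bullet> v t = (if s = t then 1 else 0)"
begin

section \<open>Monomials, polydiscs and majorants\<close>

definition monom_at :: "(nat \<Rightarrow> nat) \<Rightarrow> 'a \<Rightarrow> real" where
  "monom_at \<beta> y = (\<Prod>s\<le>p. (y \<bullet> v s) ^ \<beta> s)"

definition total_deg :: "(nat \<Rightarrow> nat) \<Rightarrow> nat" where
  "total_deg \<beta> = (\<Sum>s\<le>p. \<beta> s)"

text \<open>Only the coordinates along \<open>v 0\<close>, ..., \<open>v p\<close> are restricted,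
  so this is a cylinder in the algebra: open and convex there, and insensitive to
  \<open>xpart v p\<close>. That is what allows derivatives at ambient points.\<close>

definition polydisc :: "'a \<Rightarrow> real \<Rightarrow> 'a set" where
  "polydisc a \<rho> = {y. \<forall>s\<le>p. \<bar>(y - a) \<bullet> v s\<bar> < \<rho>}"

text \<open>The exponents \<open>\<beta> n\<close> need not be distinct: sums of functions then interleave, and
  differentiation acts on each term separately, without reindexing.\<close>

definition represents :: "'a \<Rightarrow> real \<Rightarrow> (nat \<Rightarrow> 'a) \<Rightarrow> (nat \<Rightarrow> nat \<Rightarrow> nat) \<Rightarrow> ('a \<Rightarrow> 'a) \<Rightarrow> bool" where
  "represents a \<rho> c \<beta> f \<longleftrightarrow>
     summable (\<lambda>n. norm (c n) * \<rho> ^ total_deg (\<beta> n)) \<and>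
     (\<forall>y \<in> Mp v p \<inter> polydisc a \<rho>. (\<lambda>n. monom_at (\<beta> n) (y - a) *\<^sub>R c n) sums f y)"

text \<open>\<open>N\<close> is any bound for the weighted coefficient sum of some representation,
  so neither uniqueness of the expansion nor a best constant is at issue. Values of \<open>f\<close>
  outside \<open>Mp v p\<close> are unconstrained.\<close>

definition majorized :: "'a \<Rightarrow> real \<Rightarrow> real \<Rightarrow> ('a \<Rightarrow> 'a) \<Rightarrow> bool" where
  "majorized a \<rho> N f \<longleftrightarrow> (\<exists>c \<beta>.
     represents a \<rho> c \<beta> f \<and> (\<Sum>n. norm (c n) * \<rho> ^ total_deg (\<beta> n)) \<le> N)"

lemma open_polydisc: "open (polydisc a \<rho>)"
proof -
  have "polydisc a \<rho> = (\<Inter>s\<in>{..p}. {y. \<bar>(y - a) \<bullet> v s\<bar> < \<rho>})"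
    by (auto simp: polydisc_def)
  moreover have "open {y. \<bar>(y - a) \<bullet> v s\<bar> < \<rho>}" for s
    by (intro open_Collect_less continuous_intros)
  ultimately show ?thesis by auto
qed

lemma convex_polydisc: "convex (polydisc a \<rho>)"
proof (rule convexI)
  fix x y and u w :: real
  assume xy: "x \<in> polydisc a \<rho>" "y \<in> polydisc a \<rho>" and uw: "0 \<le> u" "0 \<le> w" "u + w = 1"
  show "u *\<^sub>R x + w *\<^sub>R y \<in> polydisc a \<rho>"
    unfolding polydisc_def
  proof (intro CollectI allI impI)
    fix s assume s: "s \<le> p"
    have "a = u *\<^sub>R a + w *\<^sub>R a" using uw by (simp flip: scaleR_left.add)
    then have "(u *\<^sub>R x + w *\<^sub>R y - a) \<bullet> v s = u * ((x - a) \<bullet> v s) + w * ((y - a) \<bullet> v s)"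
      by (metis (no_types, lifting) add_diff_add inner_add_left inner_scaleR_left scaleR_diff_right)
    moreover have "\<bar>(x - a) \<bullet> v s\<bar> < \<rho>" "\<bar>(y - a) \<bullet> v s\<bar> < \<rho>" 
      using xy s by (auto simp: polydisc_def)
    ultimately show "\<bar>(u *\<^sub>R x + w *\<^sub>R y - a) \<bullet> v s\<bar> < \<rho>"
      using convex_bound_lt[of "(x - a) \<bullet> v s" \<rho> "(y - a) \<bullet> v s" u w]
        convex_bound_lt[of "-((x - a) \<bullet> v s)" \<rho> "-((y - a) \<bullet> v s)" u w] uw
      by (auto simp: abs_less_iff)
  qed
qed

lemma polydisc_mono: "\<sigma> \<le> \<rho> \<Longrightarrow> polydisc a \<sigma> \<subseteq> polydisc a \<rho>"
  by (force simp: polydisc_def)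

lemma center_in_polydisc: "0 < \<rho> \<Longrightarrow> a \<in> polydisc a \<rho>"
  by (simp add: polydisc_def)

lemma v_in_Mp: "s \<le> p \<Longrightarrow> v s \<in> Mp v p"
  by (auto simp: Mp_def intro: span_base)

lemma xpart_in_Mp [simp]: "xpart v p x \<in> Mp v p"
  unfolding xpart_def Mp_def by (intro span_sum span_scale span_base) auto

lemma xpart_inner [simp]: "s \<le> p \<Longrightarrow> xpart v p x \<bullet> v s = x \<bullet> v s"
  by (simp add: xpart_def inner_sum_left orthonormal if_distrib sum.delta cong: if_cong)

lemma linear_xpart: "linear (xpart v p)"
  unfolding xpart_def by (intro linear_compose_sum linearI ballI) (auto simp: inner_add_left algebra_simps)

lemma xpart_v: "s \<le> p \<Longrightarrow> xpart v p (v s) = v s"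
  by (simp add: xpart_def orthonormal if_distrib[of "\<lambda>x. x *\<^sub>R _"] sum.delta cong: if_cong)

lemma xpart_Mp: "y \<in> Mp v p \<Longrightarrow> xpart v p y = y"
  unfolding Mp_def by (induction rule: span_induct)
    (auto simp: xpart_v subspace_def linear_0[OF linear_xpart] linear_add[OF linear_xpart]
       linear_cmul[OF linear_xpart])

lemma xpart_in_polydisc [simp]: "xpart v p x \<in> polydisc a \<rho> \<longleftrightarrow> x \<in> polydisc a \<rho>"
  by (auto simp: polydisc_def inner_diff_left)

lemma subspace_Mp: "subspace (Mp v p)"
  by (simp add: Mp_def)

lemma Mp_line: "y \<in> Mp v p \<Longrightarrow> s \<le> p \<Longrightarrow> y + t *\<^sub>R v s \<in> Mp v p"
  using subspace_Mp v_in_Mp by (meson subspace_add subspace_scale)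

lemma monom_at_xpart [simp]: "a \<in> Mp v p \<Longrightarrow> monom_at \<beta> (xpart v p x - a) = monom_at \<beta> (x - a)"
  by (auto simp: monom_at_def inner_diff_left intro!: prod.cong)

lemma monom_at_bound:
  assumes "y \<in> polydisc a \<rho>"
  shows "\<bar>monom_at \<beta> (y - a)\<bar> \<le> \<rho> ^ total_deg \<beta>"
  unfolding monom_at_def total_deg_def abs_prod power_sum
  by (rule prod_mono) (use assms in \<open>auto simp: polydisc_def power_abs intro!: power_mono intro: less_imp_le\<close>)

section \<open>Bounds and closure properties of majorized functions\<close>

lemma majorized_bound:
  assumes "majorized a \<rho> N f" "0 \<le> \<rho>" "y \<in> Mp v p" "y \<in> polydisc a \<rho>"
  shows "norm (f y) \<le> N"
proof -
  obtain c \<beta> where c: "summable (\<lambda>n. norm (c n) * \<rho> ^ total_deg (\<beta> n))"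
     "(\<Sum>n. norm (c n) * \<rho> ^ total_deg (\<beta> n)) \<le> N"
     "(\<lambda>n. monom_at (\<beta> n) (y - a) *\<^sub>R c n) sums f y"
    using assms by (auto simp: majorized_def represents_def)
  have "norm (f y) = norm (\<Sum>n. monom_at (\<beta> n) (y - a) *\<^sub>R c n)"
    using c(3) sums_unique by metis
  also have "\<dots> \<le> (\<Sum>n. norm (c n) * \<rho> ^ total_deg (\<beta> n))"
  proof (rule norm_suminf_le[OF _ c(1)])
    show "norm (monom_at (\<beta> n) (y - a) *\<^sub>R c n) \<le> norm (c n) * \<rho> ^ total_deg (\<beta> n)" for n
      using monom_at_bound[OF assms(4), of "\<beta> n"] by (simp add: mult.commute mult_left_mono)
  qed
  finally show ?thesis using c(2) by simp
qed

lemma majorized_mono: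
  assumes "majorized a \<rho> N f" "0 \<le> \<sigma>" "\<sigma> \<le> \<rho>" "N \<le> N'"
  shows "majorized a \<sigma> N' f"
proof -
  obtain c \<beta> where c: "summable (\<lambda>n. norm (c n) * \<rho> ^ total_deg (\<beta> n))"
     "(\<Sum>n. norm (c n) * \<rho> ^ total_deg (\<beta> n)) \<le> N"
     "\<forall>y \<in> Mp v p \<inter> polydisc a \<rho>. (\<lambda>n. monom_at (\<beta> n) (y - a) *\<^sub>R c n) sums f y"
    using assms by (auto simp: majorized_def represents_def)
  have le: "norm (c n) * \<sigma> ^ total_deg (\<beta> n) \<le> norm (c n) * \<rho> ^ total_deg (\<beta> n)" for n
    using assms by (intro mult_left_mono power_mono) auto
  have s: "summable (\<lambda>n. norm (c n) * \<sigma> ^ total_deg (\<beta> n))"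
    by (rule summable_comparison_test'[OF c(1), of 0]) (use le assms in auto)
  have "(\<Sum>n. norm (c n) * \<sigma> ^ total_deg (\<beta> n)) \<le> N'"
    using suminf_le[OF le s c(1)] c(2) assms by linarith
  then show ?thesis
    unfolding majorized_def represents_def using s c(3) polydisc_mono[OF assms(3)] by blast
qed

lemma majorized_linear:
  assumes "majorized a \<rho> N f" "0 \<le> \<rho>" "linear L" "\<And>x. norm (L x) \<le> B * norm x" "0 \<le> B"
  shows "majorized a \<rho> (B * N) (\<lambda>y. L (f y))"
proof -
  obtain c \<beta> where c: "summable (\<lambda>n. norm (c n) * \<rho> ^ total_deg (\<beta> n))"
     "(\<Sum>n. norm (c n) * \<rho> ^ total_deg (\<beta> n)) \<le> N"
     "\<forall>y \<in> Mp v p \<inter> polydisc a \<rho>. (\<lambda>n. monom_at (\<beta> n) (y - a) *\<^sub>R c n) sums f y"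
    using assms by (auto simp: majorized_def represents_def)
  interpret L: bounded_linear L
    using assms(3) by (simp add: linear_linear)
  have le: "norm (L (c n)) * \<rho> ^ total_deg (\<beta> n) \<le> B * (norm (c n) * \<rho> ^ total_deg (\<beta> n))" for n
    using assms mult_right_mono[OF assms(4)[of "c n"]] by (simp add: mult.assoc)
  have s: "summable (\<lambda>n. norm (L (c n)) * \<rho> ^ total_deg (\<beta> n))"
    by (rule summable_comparison_test'[OF summable_mult[OF c(1), of B], of 0])
       (use le assms in auto)
  have "(\<Sum>n. norm (L (c n)) * \<rho> ^ total_deg (\<beta> n)) \<le> B * N"
    using suminf_le[OF le s summable_mult[OF c(1)]] suminf_mult[OF c(1), of B]
      mult_left_mono[OF c(2) assms(5)] by linarith
  moreover have "\<forall>y \<in> Mp v p \<inter> polydisc a \<rho>. (\<lambda>n. monom_at (\<beta> n) (y - a) *\<^sub>R L (c n)) sums L (f y)"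
    using L.sums[OF c(3)[rule_format]] by (simp add: L.scaleR)
  ultimately show ?thesis
    unfolding majorized_def represents_def using s by (intro exI[of _ "\<lambda>n. L (c n)"] exI[of _ \<beta>]) auto
qed

lemma majorized_zero: "majorized a \<rho> 0 (\<lambda>y. 0)"
  unfolding majorized_def represents_def by (rule exI[of _ "\<lambda>_. 0"]) auto

lemma majorized_add:
  assumes "majorized a \<rho> N f" "majorized a \<rho> N' g"
  shows "majorized a \<rho> (N + N') (\<lambda>y. f y + g y)"
proof -
  obtain c \<beta> where c: "summable (\<lambda>n. norm (c n) * \<rho> ^ total_deg (\<beta> n))"
     "(\<Sum>n. norm (c n) * \<rho> ^ total_deg (\<beta> n)) \<le> N"
     "\<forall>y \<in> Mp v p \<inter> polydisc a \<rho>. (\<lambda>n. monom_at (\<beta> n) (y - a) *\<^sub>R c n) sums f y"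
    using assms by (auto simp: majorized_def represents_def)
  obtain d \<gamma> where d: "summable (\<lambda>n. norm (d n) * \<rho> ^ total_deg (\<gamma> n))"
     "(\<Sum>n. norm (d n) * \<rho> ^ total_deg (\<gamma> n)) \<le> N'"
     "\<forall>y \<in> Mp v p \<inter> polydisc a \<rho>. (\<lambda>n. monom_at (\<gamma> n) (y - a) *\<^sub>R d n) sums g y"
    using assms by (auto simp: majorized_def represents_def)
  define e where "e n = (if even n then c (n div 2) else d (n div 2))" for n
  define \<epsilon> where "\<epsilon> n = (if even n then \<beta> (n div 2) else \<gamma> (n div 2))" for n
  have "(\<lambda>n. norm (e n) * \<rho> ^ total_deg (\<epsilon> n)) sums
      ((\<Sum>n. norm (c n) * \<rho> ^ total_deg (\<beta> n)) + (\<Sum>n. norm (d n) * \<rho> ^ total_deg (\<gamma> n)))"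
    using sums_interleave[OF summable_sums[OF c(1)] summable_sums[OF d(1)]]
    by (rule back_subst[of "\<lambda>f. f sums _"]) (auto simp: e_def \<epsilon>_def)
  moreover have "(\<lambda>n. monom_at (\<epsilon> n) (y - a) *\<^sub>R e n) sums (f y + g y)"
    if "y \<in> Mp v p \<inter> polydisc a \<rho>" for y
    using sums_interleave[OF c(3)[rule_format, OF that] d(3)[rule_format, OF that]]
    by (rule back_subst[of "\<lambda>f. f sums _"]) (auto simp: e_def \<epsilon>_def)
  ultimately show ?thesis
    unfolding majorized_def represents_def using c(2) d(2)
    by (intro exI[of _ e] exI[of _ \<epsilon>]) (auto dest: sums_summable sums_unique[symmetric])
qed

lemma majorized_sum:
  assumes "finite S" "\<And>s. s \<in> S \<Longrightarrow> majorized a \<rho> (N s) (f s)"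
  shows "majorized a \<rho> (\<Sum>s\<in>S. N s) (\<lambda>y. \<Sum>s\<in>S. f s y)"
  using assms by (induction S rule: finite_induct) (auto intro: majorized_zero majorized_add)

section \<open>Termwise differentiation\<close>

text \<open>Truncated subtraction is harmless: in a derivative the lowered monomial carries the
  coefficient \<open>of_nat (\<beta> s)\<close>, which vanishes when there is nothing to
  lower.\<close>

abbreviation lower :: "nat \<Rightarrow> (nat \<Rightarrow> nat) \<Rightarrow> nat \<Rightarrow> nat" where
  "lower s \<beta> \<equiv> \<beta>(s := \<beta> s - 1)"

lemma norm_v: "s \<le> p \<Longrightarrow> norm (v s) = 1"
  using orthonormal[of s s] by (simp add: norm_eq_sqrt_inner)

lemma inner_v_le: "s \<le> p \<Longrightarrow> \<bar>h \<bullet> v s\<bar> \<le> norm h"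
  using Cauchy_Schwarz_ineq2[of h "v s"] by (simp add: norm_v)

lemma monom_at_has_derivative:
  "((\<lambda>y. monom_at \<beta> (y - a)) has_derivative
     (\<lambda>h. \<Sum>s\<le>p. (h \<bullet> v s) * (of_nat (\<beta> s) * monom_at (lower s \<beta>) (y - a)))) (at y)"
proof -
  have "((\<lambda>y. \<Prod>s\<le>p. ((y - a) \<bullet> v s) ^ \<beta> s) has_derivative
     (\<lambda>h. \<Sum>s\<le>p. (of_nat (\<beta> s) * (h \<bullet> v s) * ((y - a) \<bullet> v s) ^ (\<beta> s - 1)) *
          (\<Prod>j\<in>{..p} - {s}. ((y - a) \<bullet> v j) ^ \<beta> j))) (at y)"
    by (rule has_derivative_prod) (auto intro!: derivative_eq_intros simp: mult_ac)
  moreover have "(of_nat (\<beta> s) * (h \<bullet> v s) * ((y - a) \<bullet> v s) ^ (\<beta> s - 1)) *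
        (\<Prod>j\<in>{..p} - {s}. ((y - a) \<bullet> v j) ^ \<beta> j) =
      (h \<bullet> v s) * (of_nat (\<beta> s) * monom_at (lower s \<beta>) (y - a))" if "s \<le> p" for s h
    using that by (simp add: monom_at_def prod.remove[of "{..p}" s] mult_ac)
  ultimately show ?thesis
    unfolding monom_at_def[of \<beta>] by (elim has_derivative_eq_rhs) (intro ext sum.cong, auto)
qed

lemma total_deg_lower: "s \<le> p \<Longrightarrow> 0 < \<beta> s \<Longrightarrow> total_deg (lower s \<beta>) = total_deg \<beta> - 1"
  by (simp add: total_deg_def sum.remove[of "{..p}" s])

lemma le_total_deg: "s \<le> p \<Longrightarrow> \<beta> s \<le> total_deg \<beta>"
  unfolding total_deg_def by (rule member_le_sum) auto

text \<open>\<open>Cauchy_power_estimate\<close> is applied at the total degree, which is at least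
  the exponent \<open>\<beta> s\<close>. The resulting loss \<open>1 / (\<rho> - \<sigma>)\<close>
  depends neither on the direction nor on the degree.\<close>

lemma lowered_term_bound:
  assumes "0 \<le> \<sigma>" "\<sigma> < \<rho>" "s \<le> p"
  shows "norm (of_nat (\<beta> s) *\<^sub>R c) * \<sigma> ^ total_deg (lower s \<beta>) \<le>
    norm c * \<rho> ^ total_deg \<beta> * (1 / (\<rho> - \<sigma>))"
proof (cases "\<beta> s = 0")
  case True
  then show ?thesis using assms by simp
next
  case False
  let ?k = "total_deg \<beta>"
  have k: "\<beta> s \<le> ?k" using assms le_total_deg by blast
  have "of_nat (\<beta> s) * \<sigma> ^ total_deg (lower s \<beta>) \<le> of_nat ?k * \<sigma> ^ (?k - 1)"
    using False assms k by (subst total_deg_lower) (auto intro!: mult_mono)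
  also have "\<dots> \<le> \<rho> ^ ?k / (\<rho> - \<sigma>)"
    using k False assms by (intro Cauchy_power_estimate) auto
  finally show ?thesis
    using mult_left_mono[of _ _ "norm c"] by (fastforce simp: mult_ac)
qed

lemma summable_lower:
  assumes "summable (\<lambda>n. norm (c n) * \<rho> ^ total_deg (\<beta> n))" "0 \<le> \<sigma>" "\<sigma> < \<rho>" "s \<le> p"
  shows "summable (\<lambda>n. norm (of_nat (\<beta> n s) *\<^sub>R c n) * \<sigma> ^ total_deg (lower s (\<beta> n)))"
    and "(\<Sum>n. norm (of_nat (\<beta> n s) *\<^sub>R c n) * \<sigma> ^ total_deg (lower s (\<beta> n))) \<le>
           (\<Sum>n. norm (c n) * \<rho> ^ total_deg (\<beta> n)) / (\<rho> - \<sigma>)"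
proof -
  let ?g = "\<lambda>n. norm (of_nat (\<beta> n s) *\<^sub>R c n) * \<sigma> ^ total_deg (lower s (\<beta> n))"
  let ?f = "\<lambda>n. norm (c n) * \<rho> ^ total_deg (\<beta> n)"
  have le: "?g n \<le> ?f n * (1 / (\<rho> - \<sigma>))" for n
    by (rule lowered_term_bound) (use assms in auto)
  show s: "summable ?g"
    by (rule summable_comparison_test'[OF summable_mult2[OF assms(1), of "1 / (\<rho> - \<sigma>)"], of 0])
       (use le assms in auto)
  show "suminf ?g \<le> suminf ?f / (\<rho> - \<sigma>)"
    using suminf_le[OF le s summable_mult2[OF assms(1)]] suminf_mult2[OF assms(1), of "1 / (\<rho> - \<sigma>)"]
    by simp
qed

text \<open>Finitely many strict inequalities leave room for a smaller radius; the majorant of a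
  differentiated series is available only after such a shrink.\<close>

lemma polydisc_shrink:
  assumes "x \<in> polydisc a \<rho>"
  obtains \<sigma> where "0 < \<sigma>" "\<sigma> < \<rho>" "x \<in> polydisc a \<sigma>"
proof -
  define \<mu> where "\<mu> = Max ((\<lambda>s. \<bar>(x - a) \<bullet> v s\<bar>) ` {..p})"
  have le: "\<bar>(x - a) \<bullet> v s\<bar> \<le> \<mu>" if "s \<le> p" for s
    unfolding \<mu>_def using that by (intro Max_ge) auto
  have "\<mu> \<in> (\<lambda>s. \<bar>(x - a) \<bullet> v s\<bar>) ` {..p}"
    unfolding \<mu>_def by (intro Max_in) auto
  then have "\<mu> < \<rho>" "0 \<le> \<mu>" using assms by (auto simp: polydisc_def)
  then show ?thesis
    using le by (intro that[of "(\<mu> + \<rho>) / 2"]) (force simp: polydisc_def)+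
qed

text \<open>\<open>f\<close> is known only on a subspace, but its composition with
  \<open>xpart v p\<close> is given by the same series on the whole open cylinder, where
  \<open>has_derivative_suminf\<close> applies.\<close>

lemma represents_has_derivative:
  assumes rep: "represents a \<rho> c \<beta> f" and a: "a \<in> Mp v p" and x: "x \<in> polydisc a \<rho>"
  shows "((\<lambda>y. f (xpart v p y)) has_derivative
     (\<lambda>h. \<Sum>s\<le>p. (h \<bullet> v s) *\<^sub>R
        (\<Sum>n. monom_at (lower s (\<beta> n)) (x - a) *\<^sub>R (of_nat (\<beta> n s) *\<^sub>R c n)))) (at x)"
    and "\<And>s. s \<le> p \<Longrightarrow>
      summable (\<lambda>n. monom_at (lower s (\<beta> n)) (x - a) *\<^sub>R (of_nat (\<beta> n s) *\<^sub>R c n))"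
proof -
  obtain \<sigma> where \<sigma>: "0 < \<sigma>" "\<sigma> < \<rho>" "x \<in> polydisc a \<sigma>"
    using polydisc_shrink x by metis
  let ?d = "\<lambda>s n. of_nat (\<beta> n s) *\<^sub>R c n"
  let ?f' = "\<lambda>n y h. \<Sum>s\<le>p. (h \<bullet> v s) *\<^sub>R (monom_at (lower s (\<beta> n)) (y - a) *\<^sub>R ?d s n)"
  let ?B = "\<lambda>s n. norm (?d s n) * \<sigma> ^ total_deg (lower s (\<beta> n))"
  have S: "summable (?B s)" if "s \<le> p" for s
    by (rule summable_lower(1)[where \<rho>=\<rho>]) (use rep \<sigma> that in \<open>auto simp: represents_def\<close>)
  have bnd: "norm (monom_at (lower s (\<beta> n)) (y - a) *\<^sub>R ?d s n) \<le> ?B s n"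
    if "y \<in> polydisc a \<sigma>" for s n y
    using mult_left_mono[OF monom_at_bound[OF that, of "lower s (\<beta> n)"], of "norm (?d s n)"]
    by (simp add: abs_mult mult_ac)
  show sd: "summable (\<lambda>n. monom_at (lower s (\<beta> n)) (x - a) *\<^sub>R ?d s n)" if "s \<le> p" for s
    by (rule summable_comparison_test'[OF S[OF that], of 0]) (use bnd \<sigma> in blast)
  have sums: "(\<lambda>n. monom_at (\<beta> n) (y - a) *\<^sub>R c n) sums f (xpart v p y)" if "y \<in> polydisc a \<rho>" for y
  proof -
    have "(\<lambda>n. monom_at (\<beta> n) (xpart v p y - a) *\<^sub>R c n) sums f (xpart v p y)"
      using rep that unfolding represents_def by simp
    then show ?thesis using a by simp
  qed
  have "((\<lambda>y. \<Sum>n. monom_at (\<beta> n) (y - a) *\<^sub>R c n) has_derivative (\<lambda>h. \<Sum>n. ?f' n x h)) (at x)"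
  proof (rule has_derivative_suminf[where M = "\<lambda>n. \<Sum>s\<le>p. ?B s n"])
    show "convex (polydisc a \<sigma>)" "open (polydisc a \<sigma>)" "x \<in> polydisc a \<sigma>"
      using convex_polydisc open_polydisc \<sigma> by auto
    show "((\<lambda>y. monom_at (\<beta> n) (y - a) *\<^sub>R c n) has_derivative ?f' n y) (at y)" for n y
      by (rule has_derivative_eq_rhs[OF has_derivative_scaleR_left[OF monom_at_has_derivative]])
         (auto simp: scaleR_sum_left mult_ac)
    show "norm (?f' n y h) \<le> (\<Sum>s\<le>p. ?B s n) * norm h" if y: "y \<in> polydisc a \<sigma>" for n y h
    proof -
      have "norm (?f' n y h) \<le> (\<Sum>s\<le>p. norm h * ?B s n)"
      proof (rule sum_norm_le)
        fix s assume "s \<in> {..p}"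
        then show "norm ((h \<bullet> v s) *\<^sub>R (monom_at (lower s (\<beta> n)) (y - a) *\<^sub>R ?d s n)) \<le> norm h * ?B s n"
          unfolding norm_scaleR[of "h \<bullet> v s"] by (intro mult_mono inner_v_le bnd y) auto
      qed
      then show ?thesis by (simp add: sum_distrib_left mult.commute)
    qed
    show "summable (\<lambda>n. \<Sum>s\<le>p. ?B s n)" by (rule summable_sum) (use S in auto)
    show "summable (\<lambda>n. monom_at (\<beta> n) (x - a) *\<^sub>R c n)" using sums x by (blast intro: sums_summable)
  qed
  then have "((\<lambda>y. f (xpart v p y)) has_derivative (\<lambda>h. \<Sum>n. ?f' n x h)) (at x)"
    by (rule has_derivative_transform_within_open[OF _ open_polydisc x]) (use sums sums_unique in metis)
  moreover have "(\<Sum>n. ?f' n x h) =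
      (\<Sum>s\<le>p. (h \<bullet> v s) *\<^sub>R (\<Sum>n. monom_at (lower s (\<beta> n)) (x - a) *\<^sub>R ?d s n))" for h
    by (rule sums_unique[symmetric], intro sums_sum sums_scaleR_right summable_sums sd) simp
  ultimately show "((\<lambda>y. f (xpart v p y)) has_derivative
     (\<lambda>h. \<Sum>s\<le>p. (h \<bullet> v s) *\<^sub>R (\<Sum>n. monom_at (lower s (\<beta> n)) (x - a) *\<^sub>R ?d s n))) (at x)"
    by simp
qed

text \<open>Lines in direction \<open>v s\<close> through points of \<open>Mp v p\<close> stay in
  \<open>Mp v p\<close>, where \<open>xpart v p\<close> is the identity.\<close>

lemma dirderiv_xpart:
  assumes "y \<in> Mp v p" "s \<le> p"
  shows "dirderiv (\<lambda>y. f (xpart v p y)) (v s) y = dirderiv f (v s) y"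
  unfolding dirderiv_def using Mp_line[OF assms] by (simp add: xpart_Mp)

lemma sum_delta_inner: "t \<le> p \<Longrightarrow> (\<Sum>s\<le>p. (v t \<bullet> v s) *\<^sub>R g s) = (g t :: 'b::real_vector)"
  by (simp add: orthonormal if_distrib[of "\<lambda>x. x *\<^sub>R _"] sum.delta' cong: if_cong)

lemma represents_sums_dirderiv:
  assumes rep: "represents a \<rho> c \<beta> f" and a: "a \<in> Mp v p"
    and x: "x \<in> polydisc a \<rho>" "x \<in> Mp v p" and s: "s \<le> p"
  shows "(\<lambda>n. monom_at (lower s (\<beta> n)) (x - a) *\<^sub>R (of_nat (\<beta> n s) *\<^sub>R c n))
     sums dirderiv f (v s) x"
proof -
  have "dirderiv f (v s) x =
      (\<Sum>n. monom_at (lower s (\<beta> n)) (x - a) *\<^sub>R (of_nat (\<beta> n s) *\<^sub>R c n))"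
    using dirderiv_eq[OF represents_has_derivative(1)[OF rep a x(1)], of "v s"] s
    by (simp add: dirderiv_xpart[OF x(2) s] sum_delta_inner del: scaleR_scaleR)
  then show ?thesis
    using summable_sums[OF represents_has_derivative(2)[OF rep a x(1) s]] by simp
qed

lemma represents_dirderiv:
  assumes "represents a \<rho> c \<beta> f" "a \<in> Mp v p" "0 \<le> \<sigma>" "\<sigma> < \<rho>" "s \<le> p"
  shows "represents a \<sigma> (\<lambda>n. of_nat (\<beta> n s) *\<^sub>R c n) (\<lambda>n. lower s (\<beta> n)) (dirderiv f (v s))"
  using assms represents_sums_dirderiv[OF assms(1,2)] polydisc_mono[of \<sigma> \<rho>] summable_lower(1)
  unfolding represents_def by (auto simp del: scaleR_scaleR)

lemma majorized_dirderiv: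
  assumes "majorized a \<rho> N f" "a \<in> Mp v p" "0 \<le> \<sigma>" "\<sigma> < \<rho>" "s \<le> p"
  shows "majorized a \<sigma> (N / (\<rho> - \<sigma>)) (dirderiv f (v s))"
proof -
  obtain c \<beta> where rep: "represents a \<rho> c \<beta> f"
    and le: "(\<Sum>n. norm (c n) * \<rho> ^ total_deg (\<beta> n)) \<le> N"
    using assms(1) unfolding majorized_def by blast
  have "summable (\<lambda>n. norm (c n) * \<rho> ^ total_deg (\<beta> n))"
    using rep unfolding represents_def by blast
  from summable_lower(2)[OF this assms(3-5)] divide_right_mono[OF le, of "\<rho> - \<sigma>"] assms(4)
  have "(\<Sum>n. norm (of_nat (\<beta> n s) *\<^sub>R c n) * \<sigma> ^ total_deg (lower s (\<beta> n))) \<le> N / (\<rho> - \<sigma>)"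
    by linarith
  then show ?thesis
    unfolding majorized_def using represents_dirderiv[OF rep assms(2-5)] by blast
qed

lemma majorized_has_derivative:
  assumes "majorized a \<rho> N f" "a \<in> Mp v p" "x \<in> polydisc a \<rho>"
  shows "((\<lambda>y. f (xpart v p y)) has_derivative
     (\<lambda>h. \<Sum>s\<le>p. (h \<bullet> v s) *\<^sub>R dirderiv f (v s) (xpart v p x))) (at x)"
proof -
  obtain c \<beta> where rep: "represents a \<rho> c \<beta> f"
    using assms(1) unfolding majorized_def by blast
  have "(\<Sum>n. monom_at (lower s (\<beta> n)) (x - a) *\<^sub>R (of_nat (\<beta> n s) *\<^sub>R c n)) =
      dirderiv f (v s) (xpart v p x)" if "s \<le> p" for s
    using represents_sums_dirderiv[OF rep assms(2), of "xpart v p x" s] that assms(2,3)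
    by (simp add: sums_unique[symmetric] del: scaleR_scaleR)
  then show ?thesis
    using represents_has_derivative(1)[OF rep assms(2,3)] by (simp del: scaleR_scaleR)
qed

text \<open>Both mixed derivatives are sums of the same series: for \<open>s \<noteq> t\<close>,
  lowering one exponent leaves the other intact, so in either order the coefficient is multiplied by
  both original exponents.\<close>

lemma majorized_dirderiv_commute:
  assumes "majorized a \<rho> N f" "a \<in> Mp v p" "x \<in> Mp v p" "x \<in> polydisc a \<rho>" "s \<le> p" "t \<le> p"
  shows "dirderiv (dirderiv f (v s)) (v t) x = dirderiv (dirderiv f (v t)) (v s) x"
proof (cases "s = t")
  case False
  obtain c \<beta> where rep: "represents a \<rho> c \<beta> f"
    using assms(1) unfolding majorized_def by blast
  obtain \<sigma> where \<sigma>: "0 < \<sigma>" "\<sigma> < \<rho>" "x \<in> polydisc a \<sigma>"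
    using polydisc_shrink assms(4) by metis
  have rs: "represents a \<sigma> (\<lambda>n. of_nat (\<beta> n s) *\<^sub>R c n) (\<lambda>n. lower s (\<beta> n)) (dirderiv f (v s))"
    if "s \<le> p" for s
    by (rule represents_dirderiv[OF rep]) (use \<sigma> assms that in auto)
  have "(\<lambda>n. monom_at (lower t (lower s (\<beta> n))) (x - a) *\<^sub>R
        (of_nat (lower s (\<beta> n) t) *\<^sub>R of_nat (\<beta> n s) *\<^sub>R c n)) sums
      dirderiv (dirderiv f (v s)) (v t) x"
    if "s \<le> p" "t \<le> p" for s t
    using represents_sums_dirderiv[OF rs[OF that(1)] assms(2) \<sigma>(3) assms(3) that(2)] .
  from sums_unique2[OF this[OF assms(5,6)]] this[OF assms(6,5)] False show ?thesis
    by (simp add: fun_upd_twist mult.commute)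
qed auto

section \<open>From unordered Taylor expansions to majorants\<close>

lemma real_analytic_imp_majorized:
  assumes ana: "real_analytic_p v p \<Omega> f" and a: "a \<in> \<Omega>" and \<Omega>: "\<Omega> \<subseteq> Mp v p"
  obtains \<rho> N where "0 < \<rho>" "majorized a \<rho> N f"
proof -
  let ?I = "{\<alpha> :: nat \<Rightarrow> nat. \<forall>s>p. \<alpha> s = 0}"
  obtain \<delta> c where \<delta>: "\<delta> > 0" and c: "\<And>h :: nat \<Rightarrow> real. (\<Sum>s\<le>p. (h s)\<^sup>2) < \<delta>\<^sup>2 \<Longrightarrow>
      ((\<lambda>\<alpha>. (\<Prod>s\<le>p. h s ^ \<alpha> s) *\<^sub>R c \<alpha>) has_sum f (a + (\<Sum>s\<le>p. h s *\<^sub>R v s))) ?I"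
    using ana[unfolded real_analytic_p_def, THEN bspec, OF a] by (elim exE conjE) (rule that, auto)
  obtain e :: "nat \<Rightarrow> nat \<Rightarrow> nat" where e: "bij_betw e UNIV ?I"
    by (rule countably_infinite_exponents)
  \<comment> \<open>With this choice the closed cube of half-side \<rho> lies inside the ball of
    radius \<delta>, because \<open>p + 1\<close> is less than the square of
    \<open>p + 2\<close>.\<close>
  define \<rho> where "\<rho> = \<delta> / (p + 2)"
  have \<rho>: "0 < \<rho>" using \<delta> by (simp add: \<rho>_def)
  have "(p + 1) * \<rho>\<^sup>2 < (p + 2) * (p + 2) * \<rho>\<^sup>2"
    using \<rho> by (intro mult_strict_right_mono) (auto simp: algebra_simps intro!: add_pos_nonneg)
  also have "\<dots> = ((p + 2) * \<rho>)\<^sup>2" by (simp add: power2_eq_square algebra_simps)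
  also have "(p + 2) * \<rho> = \<delta>" by (simp add: \<rho>_def add_eq_0_iff)
  finally have lt: "(p + 1) * \<rho>\<^sup>2 < \<delta>\<^sup>2" .
  have small: "(\<Sum>s\<le>p. (h s)\<^sup>2) < \<delta>\<^sup>2" if "\<And>s. s \<le> p \<Longrightarrow> \<bar>h s\<bar> \<le> \<rho>" for h :: "nat \<Rightarrow> real"
  proof -
    have "(\<Sum>s\<le>p. (h s)\<^sup>2) \<le> (\<Sum>s\<le>p. \<rho>\<^sup>2)"
      using that \<rho> by (intro sum_mono) (auto simp: abs_le_square_iff[symmetric])
    then show ?thesis using lt by simp
  qed
  \<comment> \<open>At the corner of the cube every monomial equals
    \<open>\<rho> ^ total_deg \<alpha>\<close>, so absolute summability there is exactly summability
    of the majorant.\<close>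
  have "(\<lambda>\<alpha>. (\<Prod>s\<le>p. \<rho> ^ \<alpha> s) *\<^sub>R c \<alpha>) summable_on ?I"
    using c[of "\<lambda>_. \<rho>"] small[of "\<lambda>_. \<rho>"] \<rho> by (auto simp: summable_on_def)
  from summable_on_euclidean_imp_abs_summable[OF this]
  have "(\<lambda>\<alpha>. norm (c \<alpha>) * \<rho> ^ total_deg \<alpha>) summable_on ?I"
    using \<rho> by (simp add: power_sum[symmetric] total_deg_def mult.commute)
  then have "(\<lambda>n. norm (c (e n)) * \<rho> ^ total_deg (e n)) summable_on UNIV"
    using summable_on_reindex_bij_betw[OF e, of "\<lambda>\<alpha>. norm (c \<alpha>) * \<rho> ^ total_deg \<alpha>"] by simp
  then have s: "summable (\<lambda>n. norm (c (e n)) * \<rho> ^ total_deg (e n))"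
    by (auto simp: summable_on_def dest!: has_sum_imp_sums sums_summable)
  have "(\<lambda>n. monom_at (e n) (y - a) *\<^sub>R c (e n)) sums f y"
    if y: "y \<in> Mp v p" "y \<in> polydisc a \<rho>" for y
  proof -
    have "y - a \<in> Mp v p" using y a \<Omega> subspace_Mp by (auto intro: subspace_diff)
    then have "a + (\<Sum>s\<le>p. ((y - a) \<bullet> v s) *\<^sub>R v s) = y"
      using xpart_Mp[of "y - a"] by (simp add: xpart_def)
    then have "((\<lambda>\<alpha>. monom_at \<alpha> (y - a) *\<^sub>R c \<alpha>) has_sum f y) ?I"
      using c[of "\<lambda>s. (y - a) \<bullet> v s"] small[of "\<lambda>s. (y - a) \<bullet> v s"] y
      by (auto simp: monom_at_def polydisc_def less_imp_le)
    then have "((\<lambda>n. monom_at (e n) (y - a) *\<^sub>R c (e n)) has_sum f y) UNIV"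
      using has_sum_reindex_bij_betw[OF e, of "\<lambda>\<alpha>. monom_at \<alpha> (y - a) *\<^sub>R c \<alpha>"] by simp
    then show ?thesis by (rule has_sum_imp_sums)
  qed
  then have "majorized a \<rho> (\<Sum>n. norm (c (e n)) * \<rho> ^ total_deg (e n)) f"
    unfolding majorized_def represents_def using s by (intro exI[of _ "\<lambda>n. c (e n)"] exI[of _ e]) auto
  then show ?thesis using that \<rho> by blast
qed

section \<open>Series in a coordinate normal to \<open>Mp v p\<close>\<close>

text \<open>The coordinate \<open>x \<bullet> w\<close> is signed, so that the axis r = 0 is an
  interior point of a power series and needs no separate treatment.\<close>

definition normal_series :: "'a \<Rightarrow> (nat \<Rightarrow> 'a \<Rightarrow> 'a) \<Rightarrow> 'a \<Rightarrow> 'a" where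
  "normal_series w H x = (\<Sum>n. ((x \<bullet> w) ^ n / fact n) *\<^sub>R H n (xpart v p x))"

text \<open>The factor \<open>fact n\<close> cancels against the one in
  \<open>normal_series\<close>, leaving a geometric majorant with ratio
  \<open>\<bar>x \<bullet> w\<bar> * K\<close>.\<close>

definition factorial_growth :: "'a \<Rightarrow> real \<Rightarrow> real \<Rightarrow> real \<Rightarrow> (nat \<Rightarrow> 'a \<Rightarrow> 'a) \<Rightarrow> bool" where
  "factorial_growth a \<sigma> N K H \<longleftrightarrow> (\<forall>n. majorized a \<sigma> (N * K ^ n * fact n) (H n))"

text \<open>The shift produces a factor \<open>n + 1\<close>; bounding it by \<open>2 ^ n\<close>
  doubles \<open>K\<close>, so the series of the normal derivative is controlled on half the
  radius.\<close>

lemma factorial_growth_Suc: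
  assumes "factorial_growth a \<sigma> N K H" "0 \<le> \<sigma>" "0 \<le> K" "0 \<le> N"
  shows "factorial_growth a \<sigma> (N * K) (2 * K) (\<lambda>n. H (Suc n))"
  unfolding factorial_growth_def
proof
  fix n
  have "real (Suc n) \<le> 2 ^ n" by (induction n) auto
  then have "N * K * K ^ n * fact n * real (Suc n) \<le> N * K * K ^ n * fact n * 2 ^ n"
    using assms by (intro mult_left_mono) auto
  then have "N * K ^ Suc n * fact (Suc n) \<le> N * K * (2 * K) ^ n * fact n"
    by (simp add: power_mult_distrib mult_ac)
  then show "majorized a \<sigma> (N * K * (2 * K) ^ n * fact n) (H (Suc n))"
    using assms by (auto simp: factorial_growth_def intro: majorized_mono)
qed

lemma factorial_growth_dirderiv:
  assumes "factorial_growth a \<sigma> N K H" "a \<in> Mp v p" "0 \<le> \<tau>" "\<tau> < \<sigma>" "s \<le> p"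
  shows "factorial_growth a \<tau> (N / (\<sigma> - \<tau>)) K (\<lambda>n. dirderiv (H n) (v s))"
  unfolding factorial_growth_def
proof
  fix n
  have "majorized a \<tau> (N * K ^ n * fact n / (\<sigma> - \<tau>)) (dirderiv (H n) (v s))"
    using assms by (intro majorized_dirderiv) (auto simp: factorial_growth_def)
  then show "majorized a \<tau> (N / (\<sigma> - \<tau>) * K ^ n * fact n) (dirderiv (H n) (v s))"
    by simp
qed

lemma factorial_growth_bound:
  assumes "factorial_growth a \<sigma> N K H" "0 \<le> \<sigma>" "x \<in> polydisc a \<sigma>" "0 \<le> r" "\<bar>t\<bar> \<le> r"
  shows "norm ((t ^ n / fact n) *\<^sub>R H n (xpart v p x)) \<le> N * (r * K) ^ n"
proof -
  have H: "norm (H n (xpart v p x)) \<le> N * K ^ n * fact n"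
    using assms by (intro majorized_bound[of a \<sigma>]) (auto simp: factorial_growth_def)
  have "norm ((t ^ n / fact n) *\<^sub>R H n (xpart v p x)) = \<bar>t\<bar> ^ n / fact n * norm (H n (xpart v p x))"
    by (simp add: power_abs)
  also have "\<dots> \<le> r ^ n / fact n * (N * K ^ n * fact n)"
    using H assms by (intro mult_mono divide_right_mono power_mono) auto
  finally show ?thesis by (simp add: power_mult_distrib mult_ac)
qed

lemma normal_series_abs_summable:
  assumes "factorial_growth a \<sigma> N K H" "0 \<le> \<sigma>" "x \<in> polydisc a \<sigma>" "\<bar>x \<bullet> w\<bar> < 1 / K" "0 < K"
  shows "summable (\<lambda>n. norm (((x \<bullet> w) ^ n / fact n) *\<^sub>R H n (xpart v p x)))"
proof (rule summable_comparison_test')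
  have "\<bar>x \<bullet> w\<bar> * K < 1" using assms by (simp add: field_simps)
  then show "summable (\<lambda>n. N * (\<bar>x \<bullet> w\<bar> * K) ^ n)"
    using assms by (intro summable_mult summable_geometric) (simp add: abs_mult)
  show "norm (norm (((x \<bullet> w) ^ n / fact n) *\<^sub>R H n (xpart v p x))) \<le> N * (\<bar>x \<bullet> w\<bar> * K) ^ n" for n
    using factorial_growth_bound[OF assms(1-3), of "\<bar>x \<bullet> w\<bar>" "x \<bullet> w" n] by simp
qed

text \<open>The sum depends on \<open>x\<close> only through \<open>x \<bullet> w\<close> and
  \<open>xpart v p x\<close>, and the product rule separates the two: the normal part shifts the
  coefficients, the tangential part differentiates them.\<close>

lemma normal_series_has_derivative:
  assumes H: "factorial_growth a \<sigma> N K H" and a: "a \<in> Mp v p" and N: "0 \<le> N"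
    and x: "x \<in> polydisc a \<sigma>" and K: "0 < K" and xw: "\<bar>x \<bullet> w\<bar> < 1 / (2 * K)" and w: "norm w = 1"
  shows "(normal_series w H has_derivative
     (\<lambda>h. (h \<bullet> w) *\<^sub>R normal_series w (\<lambda>n. H (Suc n)) x +
          (\<Sum>s\<le>p. (h \<bullet> v s) *\<^sub>R normal_series w (\<lambda>n. dirderiv (H n) (v s)) x))) (at x)"
proof -
  obtain \<tau> where \<tau>: "0 < \<tau>" "\<tau> < \<sigma>" "x \<in> polydisc a \<tau>"
    using polydisc_shrink x by metis
  define r where "r = 1 / (2 * K)"
  have r: "0 < r" "r * K = 1 / 2" using K by (auto simp: r_def)
  let ?S = "polydisc a \<tau> \<inter> {y. \<bar>y \<bullet> w\<bar> < r}"
  let ?xp = "xpart v p"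
  let ?D = "\<lambda>s n. dirderiv (H n) (v s)"
  let ?f1 = "\<lambda>n y h. \<Sum>s\<le>p. (h \<bullet> v s) *\<^sub>R (((y \<bullet> w) ^ n / fact n) *\<^sub>R ?D s n (?xp y))"
  let ?f2 = "\<lambda>n y h. (h \<bullet> w) *\<^sub>R ((of_nat n * (y \<bullet> w) ^ (n - 1) / fact n) *\<^sub>R H n (?xp y))"
  let ?N1 = "real (Suc p) * (N / (\<sigma> - \<tau>))"
  have D: "factorial_growth a \<tau> (N / (\<sigma> - \<tau>)) K (?D s)" if "s \<le> p" for s
    using factorial_growth_dirderiv[OF H a] \<tau> that by simp
  have HS: "factorial_growth a \<sigma> (N * K) (2 * K) (\<lambda>n. H (Suc n))"
    using factorial_growth_Suc[OF H] \<tau> K N by simp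
  have xS: "x \<in> ?S" using \<tau> xw by (simp add: r_def)
  have xw': "\<bar>x \<bullet> w\<bar> < 1 / K"
    using xw K by (simp add: field_simps)
  have "((\<lambda>y. \<Sum>n. ((y \<bullet> w) ^ n / fact n) *\<^sub>R H n (?xp y)) has_derivative
          (\<lambda>h. \<Sum>n. ?f1 n x h + ?f2 n x h)) (at x)"
  \<comment> \<open>Since \<open>r * K = 1 / 2\<close>, tangential derivatives are dominated by
    powers of 1/2. Normal ones carry an extra factor \<open>n\<close>, absorbed by passing to powers
    of 3/4; the constant 4 is \<open>1 / (3/4 - 1/2)\<close> from
    \<open>Cauchy_power_estimate\<close>.\<close>
  proof (rule has_derivative_suminf[where M = "\<lambda>n. ?N1 * (1/2) ^ n + N * K * (4 * (3/4) ^ n)"])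
    have "{y. \<bar>y \<bullet> w\<bar> < r} = {y. inner w y < r} \<inter> {y. inner w y > - r}"
      by (auto simp: inner_commute)
    then show "convex ?S"
      by (auto intro!: convex_Int convex_polydisc convex_halfspace_lt convex_halfspace_gt)
    show "open ?S"
      by (intro open_Int open_polydisc open_Collect_less continuous_intros)
    show "x \<in> ?S" by (fact xS)
    show "summable (\<lambda>n. ?N1 * (1/2) ^ n + N * K * (4 * (3/4) ^ n))"
      by (intro summable_add summable_mult summable_geometric) auto
    show "summable (\<lambda>n. ((x \<bullet> w) ^ n / fact n) *\<^sub>R H n (?xp x))"
      using normal_series_abs_summable[OF H _ x xw' K] \<tau> by (auto intro: summable_norm_cancel)
    fix n y h assume y: "y \<in> ?S"
    then have y\<sigma>: "y \<in> polydisc a \<sigma>" using polydisc_mono[of \<tau> \<sigma>] \<tau> by auto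
    have Hd: "((\<lambda>y. H n (?xp y)) has_derivative (\<lambda>h. \<Sum>s\<le>p. (h \<bullet> v s) *\<^sub>R ?D s n (?xp y))) (at y)"
      using H a y\<sigma> by (intro majorized_has_derivative) (auto simp: factorial_growth_def)
    have pd: "((\<lambda>y. (y \<bullet> w) ^ n / fact n) has_derivative
        (\<lambda>h. (h \<bullet> w) * (of_nat n * (y \<bullet> w) ^ (n - 1) / fact n))) (at y)"
      by (auto intro!: derivative_eq_intros)
    show "((\<lambda>y. ((y \<bullet> w) ^ n / fact n) *\<^sub>R H n (?xp y)) has_derivative
        (\<lambda>h. ?f1 n y h + ?f2 n y h)) (at y)"
      by (rule has_derivative_eq_rhs[OF has_derivative_scaleR[OF pd Hd]])
         (auto simp: scaleR_sum_right mult_ac)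
    have "norm (?f1 n y h) \<le> (\<Sum>s\<le>p. norm h * (N / (\<sigma> - \<tau>) * (r * K) ^ n))"
    proof (rule sum_norm_le)
      fix s assume "s \<in> {..p}"
      then show "norm ((h \<bullet> v s) *\<^sub>R (((y \<bullet> w) ^ n / fact n) *\<^sub>R ?D s n (?xp y)))
          \<le> norm h * (N / (\<sigma> - \<tau>) * (r * K) ^ n)"
        unfolding norm_scaleR[of "h \<bullet> v s"]
        using y \<tau> r by (intro mult_mono inner_v_le factorial_growth_bound[OF D]) auto
    qed
    then have b1: "norm (?f1 n y h) \<le> ?N1 * (1/2) ^ n * norm h"
      unfolding r(2) by (simp add: mult_ac)
    have b2: "norm (?f2 n y h) \<le> N * K * (4 * (3/4) ^ n) * norm h"
    proof (cases n)
      case (Suc k)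
      have hw: "\<bar>h \<bullet> w\<bar> \<le> norm h" using Cauchy_Schwarz_ineq2[of h w] w by simp
      have "norm ((of_nat n * (y \<bullet> w) ^ (n - 1) / fact n) *\<^sub>R H n (?xp y)) =
          \<bar>y \<bullet> w\<bar> ^ k / fact k * norm (H n (?xp y))"
        using Suc by (simp add: abs_mult power_abs)
      also have "\<dots> \<le> r ^ k / fact k * (N * K ^ n * fact n)"
        using y r H y\<sigma> \<tau>
        by (intro mult_mono divide_right_mono power_mono majorized_bound[of a \<sigma>])
           (auto simp: factorial_growth_def)
      also have "\<dots> = N * K * (of_nat n * (r * K) ^ (n - 1))"
        using Suc by (simp add: power_mult_distrib field_simps)
      also have "\<dots> \<le> N * K * ((3/4) ^ n / (3/4 - 1/2))"
        unfolding r(2) using Suc N K by (intro mult_left_mono Cauchy_power_estimate) auto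
      finally have "norm ((of_nat n * (y \<bullet> w) ^ (n - 1) / fact n) *\<^sub>R H n (?xp y)) \<le> N * K * (4 * (3/4) ^ n)"
        by simp
      then have "\<bar>h \<bullet> w\<bar> * norm ((of_nat n * (y \<bullet> w) ^ (n - 1) / fact n) *\<^sub>R H n (?xp y))
          \<le> norm h * (N * K * (4 * (3/4) ^ n))"
        by (intro mult_mono hw) auto
      then show ?thesis
        unfolding norm_scaleR[of "h \<bullet> w"] by (simp only: mult.commute)
    qed (use N K in simp)
    show "norm (?f1 n y h + ?f2 n y h) \<le> (?N1 * (1/2) ^ n + N * K * (4 * (3/4) ^ n)) * norm h"
      using norm_triangle_le[OF add_mono[OF b1 b2]] by (simp only: distrib_right)
  qed
  moreover have "(\<Sum>n. ?f1 n x h + ?f2 n x h) =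
      (h \<bullet> w) *\<^sub>R normal_series w (\<lambda>n. H (Suc n)) x +
      (\<Sum>s\<le>p. (h \<bullet> v s) *\<^sub>R normal_series w (\<lambda>n. dirderiv (H n) (v s)) x)" for h
  proof -
    have "(\<lambda>n. ((x \<bullet> w) ^ n / fact n) *\<^sub>R ?D s n (?xp x)) sums
        normal_series w (\<lambda>n. dirderiv (H n) (v s)) x" if "s \<le> p" for s
      unfolding normal_series_def using \<tau>
      by (intro summable_sums summable_norm_cancel[OF normal_series_abs_summable[OF D[OF that] _ \<tau>(3) xw' K]])
         simp
    then have s1: "(\<lambda>n. ?f1 n x h) sums
        (\<Sum>s\<le>p. (h \<bullet> v s) *\<^sub>R normal_series w (\<lambda>n. dirderiv (H n) (v s)) x)"
      by (intro sums_sum sums_scaleR_right) auto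
    have "summable (\<lambda>n. ((x \<bullet> w) ^ n / fact n) *\<^sub>R H (Suc n) (?xp x))"
      using K \<tau> by (intro summable_norm_cancel[OF normal_series_abs_summable[OF HS _ x xw]]) auto
    then have "(\<lambda>n. (h \<bullet> w) *\<^sub>R (((x \<bullet> w) ^ n / fact n) *\<^sub>R H (Suc n) (?xp x))) sums
        ((h \<bullet> w) *\<^sub>R normal_series w (\<lambda>n. H (Suc n)) x)"
      unfolding normal_series_def by (intro sums_scaleR_right summable_sums)
    moreover have eq: "(h \<bullet> w) *\<^sub>R (((x \<bullet> w) ^ n / fact n) *\<^sub>R H (Suc n) (?xp x)) = ?f2 (Suc n) x h" for n
      by (simp del: of_nat_Suc)
    ultimately have "(\<lambda>n. ?f2 (Suc n) x h) sums ((h \<bullet> w) *\<^sub>R normal_series w (\<lambda>n. H (Suc n)) x)"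
      unfolding eq by blast
    then have s2: "(\<lambda>n. ?f2 n x h) sums ((h \<bullet> w) *\<^sub>R normal_series w (\<lambda>n. H (Suc n)) x)"
      \<comment> \<open>The term of \<open>?f2\<close> at index 0 vanishes through its factor
        \<open>of_nat n\<close>, so restoring it does not change the sum.\<close>
      by (subst (asm) sums_Suc_iff) simp
    show ?thesis using sums_unique[OF sums_add[OF s1 s2]] by (simp only: add.commute)
  qed
  ultimately show ?thesis
    unfolding normal_series_def[of w H, abs_def] by simp
qed

section \<open>Local majorization and the calculus of directional derivatives\<close>

text \<open>The constants are dropped: identities between derivatives at a point need only some
  majorant centred there, whereas convergence uses the quantitative form.\<close>

definition locally_majorized :: "'a set \<Rightarrow> ('a \<Rightarrow> 'a) \<Rightarrow> bool" where
  "locally_majorized \<Omega> g \<longleftrightarrow> (\<forall>a\<in>\<Omega>. \<exists>\<rho>>0. \<exists>N. majorized a \<rho> N g)"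

lemma locally_majorizedE:
  assumes "locally_majorized \<Omega> g" "a \<in> \<Omega>"
  obtains \<rho> N where "0 < \<rho>" "majorized a \<rho> N g"
  using assms unfolding locally_majorized_def by blast

lemma locally_majorized_dirderiv:
  assumes "locally_majorized \<Omega> g" "\<Omega> \<subseteq> Mp v p" "s \<le> p"
  shows "locally_majorized \<Omega> (dirderiv g (v s))"
  unfolding locally_majorized_def
proof
  fix a assume a: "a \<in> \<Omega>"
  then obtain \<rho> N where "0 < \<rho>" "majorized a \<rho> N g"
    using assms locally_majorizedE by metis
  then have "majorized a (\<rho> / 2) (N / (\<rho> - \<rho> / 2)) (dirderiv g (v s))"
    using assms a by (intro majorized_dirderiv) auto
  then show "\<exists>\<rho>>0. \<exists>N. majorized a \<rho> N (dirderiv g (v s))"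
    using \<open>0 < \<rho>\<close> half_gt_zero by blast
qed

lemma locally_majorized_linear:
  assumes "locally_majorized \<Omega> g" "linear L"
  shows "locally_majorized \<Omega> (\<lambda>y. L (g y))"
  unfolding locally_majorized_def
proof
  fix a assume a: "a \<in> \<Omega>"
  then obtain \<rho> N where "0 < \<rho>" "majorized a \<rho> N g"
    using assms locally_majorizedE by metis
  moreover obtain B where "0 < B" "\<And>x. norm (L x) \<le> B * norm x"
    using linear_bounded_pos[OF assms(2)] by blast
  ultimately have "majorized a \<rho> (B * N) (\<lambda>y. L (g y))"
    using assms by (intro majorized_linear) auto
  then show "\<exists>\<rho>>0. \<exists>N. majorized a \<rho> N (\<lambda>y. L (g y))"
    using \<open>0 < \<rho>\<close> by blast
qed

lemma locally_majorized_add: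
  assumes "locally_majorized \<Omega> f" "locally_majorized \<Omega> g"
  shows "locally_majorized \<Omega> (\<lambda>y. f y + g y)"
  unfolding locally_majorized_def
proof
  fix a assume a: "a \<in> \<Omega>"
  obtain \<rho> N where 1: "0 < \<rho>" "majorized a \<rho> N f"
    using assms(1) a by (rule locally_majorizedE)
  obtain \<rho>' N' where 2: "0 < \<rho>'" "majorized a \<rho>' N' g"
    using assms(2) a by (rule locally_majorizedE)
  have "majorized a (min \<rho> \<rho>') (N + N') (\<lambda>y. f y + g y)"
    using 1 2 by (intro majorized_add) (auto intro: majorized_mono)
  then show "\<exists>\<rho>>0. \<exists>N. majorized a \<rho> N (\<lambda>y. f y + g y)"
    using 1 2 by (intro exI[of _ "min \<rho> \<rho>'"]) auto
qed

lemma locally_majorized_sum: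
  assumes "finite S" "\<And>s. s \<in> S \<Longrightarrow> locally_majorized \<Omega> (g s)"
  shows "locally_majorized \<Omega> (\<lambda>y. \<Sum>s\<in>S. g s y)"
  using assms
proof (induction S rule: finite_induct)
  case empty
  have "majorized a 1 0 (\<lambda>y. 0)" for a by (rule majorized_zero)
  then show ?case
    unfolding locally_majorized_def sum.empty using zero_less_one by blast
qed (auto intro: locally_majorized_add)

lemma locally_majorized_has_derivative:
  assumes "locally_majorized \<Omega> g" "\<Omega> \<subseteq> Mp v p" "x \<in> \<Omega>"
  shows "((\<lambda>y. g (xpart v p y)) has_derivative (\<lambda>h. \<Sum>s\<le>p. (h \<bullet> v s) *\<^sub>R dirderiv g (v s) x)) (at x)"
proof -
  obtain \<rho> N where "0 < \<rho>" "majorized x \<rho> N g"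
    using assms(1,3) by (rule locally_majorizedE)
  then show ?thesis
    using majorized_has_derivative[of x \<rho> N g x] assms center_in_polydisc xpart_Mp[of x] by auto
qed

text \<open>\<open>dirderiv\<close> is total and obeys rules of calculus only where derivatives
  exist. Local majorization supplies them, and the chain rule is applied to the composition with
  \<open>xpart v p\<close>.\<close>

lemma dirderiv_linear:
  assumes "locally_majorized \<Omega> g" "\<Omega> \<subseteq> Mp v p" "x \<in> \<Omega>" "s \<le> p" "linear L"
  shows "dirderiv (\<lambda>y. L (g y)) (v s) x = L (dirderiv g (v s) x)"
proof -
  have L: "bounded_linear L" using assms(5) by (simp add: linear_linear)
  have "dirderiv (\<lambda>y. L (g (xpart v p y))) (v s) x = L (\<Sum>t\<le>p. (v s \<bullet> v t) *\<^sub>R dirderiv g (v t) x)"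
    by (rule dirderiv_eq[OF bounded_linear.has_derivative[OF L
          locally_majorized_has_derivative[OF assms(1-3)]]])
  then show ?thesis
    using dirderiv_xpart[of x s "\<lambda>y. L (g y)"] assms by (auto simp: sum_delta_inner)
qed

lemma dirderiv_sum:
  assumes "\<And>t. t \<in> S \<Longrightarrow> locally_majorized \<Omega> (g t)" "\<Omega> \<subseteq> Mp v p" "x \<in> \<Omega>" "s \<le> p"
  shows "dirderiv (\<lambda>y. \<Sum>t\<in>S. g t y) (v s) x = (\<Sum>t\<in>S. dirderiv (g t) (v s) x)"
proof -
  have "((\<lambda>y. \<Sum>t\<in>S. g t (xpart v p y)) has_derivative
      (\<lambda>h. \<Sum>t\<in>S. \<Sum>r\<le>p. (h \<bullet> v r) *\<^sub>R dirderiv (g t) (v r) x)) (at x)"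
    using assms by (intro has_derivative_sum locally_majorized_has_derivative)
  from dirderiv_eq[OF this] have "dirderiv (\<lambda>y. \<Sum>t\<in>S. g t (xpart v p y)) (v s) x =
      (\<Sum>t\<in>S. dirderiv (g t) (v s) x)" using assms(4) by (simp add: sum_delta_inner)
  then show ?thesis
    using dirderiv_xpart[of x s "\<lambda>y. \<Sum>t\<in>S. g t y"] assms by auto
qed

text \<open>Relative openness suffices because the directions \<open>v s\<close> do not leave
  \<open>Mp v p\<close>. Since iterated operators are identified only on \<Omega>, each further
  derivative has to be carried over in this way.\<close>

lemma dirderiv_cong_on:
  assumes "openin (top_of_set (Mp v p)) \<Omega>" "x \<in> \<Omega>" "s \<le> p" "\<And>y. y \<in> \<Omega> \<Longrightarrow> f y = g y"
  shows "dirderiv f (v s) x = dirderiv g (v s) x"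
proof -
  obtain U where U: "open U" "\<Omega> = Mp v p \<inter> U"
    using assms(1) by (auto simp: openin_open)
  show ?thesis
    by (rule dirderiv_cong[OF U(1)]) (use assms Mp_line U(2) in auto)
qed

lemma Lapxp_cong_on:
  assumes "openin (top_of_set (Mp v p)) \<Omega>" "x \<in> \<Omega>" "\<And>y. y \<in> \<Omega> \<Longrightarrow> f y = g y"
  shows "Lapxp v p f x = Lapxp v p g x"
  unfolding Lapxp_def
proof (rule sum.cong[OF refl])
  fix s assume s: "s \<in> {..p}"
  show "dirderiv (dirderiv f (v s)) (v s) x = dirderiv (dirderiv g (v s)) (v s) x"
    by (rule dirderiv_cong_on[OF assms(1,2)], use s in simp)
       (rule dirderiv_cong_on[OF assms(1)], use s assms(3) in auto)
qed

lemma Lapxp_linear: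
  assumes "openin (top_of_set (Mp v p)) \<Omega>" "locally_majorized \<Omega> g" "x \<in> \<Omega>" "linear L"
  shows "Lapxp v p (\<lambda>y. L (g y)) x = L (Lapxp v p g x)"
proof -
  have \<Omega>: "\<Omega> \<subseteq> Mp v p" using openin_imp_subset[OF assms(1)] .
  have "dirderiv (dirderiv (\<lambda>y. L (g y)) (v s)) (v s) x = L (dirderiv (dirderiv g (v s)) (v s) x)"
    if s: "s \<le> p" for s
  proof -
    have "dirderiv (dirderiv (\<lambda>y. L (g y)) (v s)) (v s) x =
        dirderiv (\<lambda>y. L (dirderiv g (v s) y)) (v s) x"
      by (rule dirderiv_cong_on[OF assms(1,3) s]) (rule dirderiv_linear[OF assms(2) \<Omega> _ s assms(4)])
    then show ?thesis
      using dirderiv_linear[OF locally_majorized_dirderiv[OF assms(2) \<Omega> s] \<Omega> assms(3) s assms(4)] by simp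
  qed
  then show ?thesis
    unfolding Lapxp_def by (simp add: linear_sum[OF assms(4)])
qed

lemma isCont_normal_series:
  assumes "factorial_growth a \<sigma> N K H" "a \<in> Mp v p" "0 \<le> N" "x \<in> polydisc a \<sigma>" "0 < K"
    "\<bar>x \<bullet> w\<bar> < 1 / (2 * K)" "norm w = 1"
  shows "isCont (normal_series w H) x"
  using has_derivative_continuous[OF normal_series_has_derivative[OF assms]] .

lemma norm_Mp_le:
  assumes "y \<in> Mp v p"
  shows "norm y \<le> (\<Sum>s\<le>p. \<bar>y \<bullet> v s\<bar>)"
proof -
  have "norm y = norm (\<Sum>s\<le>p. (y \<bullet> v s) *\<^sub>R v s)"
    using xpart_Mp[OF assms] by (simp add: xpart_def)
  also have "\<dots> \<le> (\<Sum>s\<le>p. \<bar>y \<bullet> v s\<bar>)"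
    by (rule sum_norm_le) (simp add: norm_v)
  finally show ?thesis .
qed

lemma polydisc_subset_open:
  assumes "openin (top_of_set (Mp v p)) \<Omega>" "a \<in> \<Omega>"
  obtains \<epsilon> where "0 < \<epsilon>" "Mp v p \<inter> polydisc a \<epsilon> \<subseteq> \<Omega>"
proof -
  obtain e where e: "0 < e" "ball a e \<inter> Mp v p \<subseteq> \<Omega>" and \<Omega>: "\<Omega> \<subseteq> Mp v p"
    using assms unfolding openin_contains_ball by blast
  \<comment> \<open>There are \<open>Suc p\<close> coordinates; if each is below
    \<open>e / Suc p\<close>, their sum, and with it the norm, is below \<open>e\<close>.\<close>
  have "y \<in> \<Omega>" if y: "y \<in> Mp v p" "y \<in> polydisc a (e / Suc p)" for y
  proof -
    have "norm (y - a) \<le> (\<Sum>s\<le>p. \<bar>(y - a) \<bullet> v s\<bar>)"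
      using y \<Omega> assms(2) subspace_Mp by (intro norm_Mp_le) (auto intro: subspace_diff)
    also have "\<dots> < (\<Sum>s\<le>p. e / Suc p)"
      using y(2) by (intro sum_strict_mono) (auto simp: polydisc_def)
    also have "\<dots> = e" by simp
    finally show "y \<in> \<Omega>" using y e(2) by (auto simp: dist_norm norm_minus_commute)
  qed
  then show ?thesis using e(1) by (intro that[of "e / Suc p"]) auto
qed

end

section \<open>The operator \<open>w D\<close>\<close>

locale slice_algebra =
  fixes mul :: "'a::euclidean_space \<Rightarrow> 'a \<Rightarrow> 'a" and one :: 'a and cj :: "'a \<Rightarrow> 'a"
    and v :: "nat \<Rightarrow> 'a" and m p :: nat
  assumes alg: "alt_algebra mul one cj"
    and bas: "basis_setup mul one cj v m"
    and pm: "p < m"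
begin

sublocale orthonormal_frame v p
  by unfold_locales (use bas pm in \<open>auto simp: basis_setup_def\<close>)

section \<open>Clifford relations for left multiplications\<close>

lemma bilinear_mul: "bilinear mul"
  using alg by (simp add: alt_algebra_def)

lemmas mul_simps = bilinear_ladd[OF bilinear_mul] bilinear_radd[OF bilinear_mul]
  bilinear_lmul[OF bilinear_mul] bilinear_rmul[OF bilinear_mul]
  bilinear_lneg[OF bilinear_mul] bilinear_rneg[OF bilinear_mul]
  bilinear_lzero[OF bilinear_mul] bilinear_rzero[OF bilinear_mul]

lemma linear_mul: "linear (mul x)"
  using bilinear_mul by (simp add: bilinear_def)

lemma bounded_linear_mul: "bounded_linear (mul x)"
  using linear_mul by (simp add: linear_linear)

lemma mul_one: "mul one x = x"
  using alg by (simp add: alt_algebra_def)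

lemma left_alternative: "mul (mul x x) y = mul x (mul x y)"
  using alg by (simp add: alt_algebra_def assoc3_def)

text \<open>Left alternativity for \<open>x + y\<close> with the pure terms cancelled. It takes the
  place of associativity for products of two left multiplications.\<close>

lemma left_alternative_polarized:
  "mul x (mul y z) + mul y (mul x z) = mul (mul x y + mul y x) z"
  using left_alternative[of "x + y" z] left_alternative[of x z] left_alternative[of y z]
  by (simp add: mul_simps algebra_simps)

abbreviation imag :: "'a set" where
  "imag \<equiv> span (v ` {1..m})"

text \<open>On the diagonal, trace zero gives \<open>cj (v s) = - v s\<close>, and then norm one
  gives square \<open>- one\<close>. Off the diagonal both sides vanish, by anticommutation and
  orthogonality.\<close>

lemma v_anticommute:
  assumes "s \<in> {1..m}" "t \<in> {1..m}"
  shows "mul (v s) (v t) + mul (v t) (v s) = (- 2 * (v s \<bullet> v t)) *\<^sub>R one"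
proof (cases "s = t")
  case True
  have "v s \<in> SA mul one cj" "v s \<bullet> v s = 1" using bas assms by (auto simp: basis_setup_def)
  then have "cj (v s) = - v s" "mul (v s) (cj (v s)) = one"
    by (auto simp: SA_def tr_def nrm_def eq_neg_iff_add_eq_0 add.commute)
  then have "mul (v s) (v s) = - one" by (simp add: mul_simps) (metis minus_minus)
  then show ?thesis using True \<open>v s \<bullet> v s = 1\<close> by (simp flip: scaleR_2)
next
  case False
  have "\<forall>s\<in>{1..m}. \<forall>t\<in>{1..m}. s \<noteq> t \<longrightarrow> mul (v s) (v t) = - mul (v t) (v s)"
    using bas unfolding basis_setup_def by blast
  with assms False have "mul (v s) (v t) = - mul (v t) (v s)" by blast
  moreover have "v s \<bullet> v t = 0"
    using bas assms False by (simp add: basis_setup_def)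
  ultimately show ?thesis by simp
qed

lemma imag_anticommute:
  assumes "x \<in> imag" "y \<in> imag"
  shows "mul x y + mul y x = (- 2 * (x \<bullet> y)) *\<^sub>R one"
  using assms(1)
proof (induction rule: span_induct)
  case base
  show "subspace {x. mul x y + mul y x = (- 2 * (x \<bullet> y)) *\<^sub>R one}"
    by (auto simp: subspace_def mul_simps inner_add_left algebra_simps scaleR_add_right[symmetric])
next
  case (step x)
  then obtain s where s: "s \<in> {1..m}" "x = v s" by blast
  show ?case using assms(2)
  proof (induction rule: span_induct)
    case base
    show "subspace {y. mul x y + mul y x = (- 2 * (x \<bullet> y)) *\<^sub>R one}"
      by (auto simp: subspace_def mul_simps inner_add_right algebra_simps scaleR_add_right[symmetric])
  next
    case (step y)
    then show ?case using v_anticommute s by blast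
  qed
qed

text \<open>A single product \<open>mul x (mul y z)\<close> cannot be rebracketed, but its
  symmetrization can, and there the product acting on \<open>z\<close> is a real multiple of
  \<open>one\<close>.\<close>

lemma imag_mul_mul:
  assumes "x \<in> imag" "y \<in> imag"
  shows "mul x (mul y z) + mul y (mul x z) = (- 2 * (x \<bullet> y)) *\<^sub>R z"
  unfolding left_alternative_polarized imag_anticommute[OF assms] by (simp add: mul_simps mul_one)

lemma v_zero: "v 0 = one"
  using bas by (simp add: basis_setup_def)

lemma v_imag: "s \<in> {1..m} \<Longrightarrow> v s \<in> imag"
  by (auto intro: span_base)

lemma Sph_imag: "w \<in> Sph v p m \<Longrightarrow> w \<in> imag"
  unfolding Sph_def Mq_def using span_mono[of "v ` {p+1..m}" "v ` {1..m}"] by force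

lemma Sph_norm: "w \<in> Sph v p m \<Longrightarrow> norm w = 1"
  by (simp add: Sph_def)

lemma Sph_inner: "w \<in> Sph v p m \<Longrightarrow> s \<le> p \<Longrightarrow> w \<bullet> v s = 0"
proof -
  assume w: "w \<in> Sph v p m" and s: "s \<le> p"
  then have "w \<in> span (v ` {p+1..m})" by (simp add: Sph_def Mq_def)
  then show ?thesis
  proof (induction rule: span_induct)
    case base show ?case by (auto simp: subspace_def inner_add_left)
  next
    case (step x)
    then show ?case using bas s pm by (auto simp: basis_setup_def)
  qed
qed

lemma Sph_square:
  assumes "w \<in> Sph v p m"
  shows "mul w (mul w x) = - x"
proof -
  have "2 *\<^sub>R mul w (mul w x) = 2 *\<^sub>R (- x)"
    using imag_mul_mul[of w w x] Sph_imag[OF assms] Sph_norm[OF assms]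
    by (simp add: dot_square_norm flip: scaleR_2)
  then show ?thesis by (simp only: scaleR_cancel_left) simp
qed

text \<open>Index 0 is excluded because \<open>v 0 = one\<close> commutes with \<open>w\<close>;
  this exception is what produces a conjugated Dirac operator in
  \<open>double_Dirac\<close>.\<close>

lemma Sph_v: "w \<in> Sph v p m \<Longrightarrow> s \<in> {1..p} \<Longrightarrow> mul (v s) (mul w x) = - mul w (mul (v s) x)"
  using imag_mul_mul[of w "v s" x, OF Sph_imag v_imag] Sph_inner[of w s] pm
  by (simp add: eq_neg_iff_add_eq_0 add.commute)

section \<open>Growth of the iterates of \<open>wD\<close>\<close>

definition wD :: "'a \<Rightarrow> ('a \<Rightarrow> 'a) \<Rightarrow> 'a \<Rightarrow> 'a" where
  "wD w g y = mul w (Dxp mul v p g y)"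

lemma mul_sum: "mul x (\<Sum>i\<in>S. g i) = (\<Sum>i\<in>S. mul x (g i))"
  using linear_sum[OF linear_mul] by blast

definition mul_bound :: real where
  "mul_bound = (SOME C. 0 < C \<and> (\<forall>x y. norm (mul x y) \<le> C * norm x * norm y))"

lemma mul_bound: "0 < mul_bound" "norm (mul x y) \<le> mul_bound * norm x * norm y"
proof -
  have "\<exists>C. 0 < C \<and> (\<forall>x y. norm (mul x y) \<le> C * norm x * norm y)"
    using bilinear_bounded_pos[OF bilinear_mul] by (auto simp: mult_ac)
  from someI_ex[OF this] show "0 < mul_bound" "norm (mul x y) \<le> mul_bound * norm x * norm y"
    unfolding mul_bound_def by blast+
qed

text \<open>\<open>Dxp\<close> has \<open>Suc p\<close> summands; each is multiplied by the unit
  vector \<open>v s\<close> and then by the unit vector \<open>w\<close>, at a cost of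
  \<open>mul_bound\<close> each time.\<close>

definition step_bound :: real where
  "step_bound = real (Suc p) * mul_bound\<^sup>2"

lemma step_bound_pos: "0 < step_bound"
  using mul_bound by (simp add: step_bound_def)

lemma majorized_Dxp:
  assumes "majorized a \<rho> N g" "a \<in> Mp v p" "0 \<le> \<sigma>" "\<sigma> < \<rho>"
  shows "majorized a \<sigma> (real (Suc p) * (mul_bound * (N / (\<rho> - \<sigma>)))) (Dxp mul v p g)"
proof -
  have "majorized a \<sigma> (\<Sum>s\<le>p. mul_bound * (N / (\<rho> - \<sigma>)))
      (\<lambda>y. \<Sum>s\<le>p. mul (v s) (dirderiv g (v s) y))"
  proof (rule majorized_sum)
    fix s assume s: "s \<in> {..p}"
    show "majorized a \<sigma> (mul_bound * (N / (\<rho> - \<sigma>))) (\<lambda>y. mul (v s) (dirderiv g (v s) y))"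
      by (rule majorized_linear)
         (use s assms majorized_dirderiv linear_mul mul_bound(1) mul_bound(2)[of "v s"] norm_v[of s]
          in auto)
  qed simp
  then show ?thesis by (simp add: Dxp_def[abs_def])
qed

lemma majorized_wD:
  assumes "majorized a \<rho> N g" "a \<in> Mp v p" "0 \<le> \<sigma>" "\<sigma> < \<rho>" "norm w = 1"
  shows "majorized a \<sigma> (N * (step_bound / (\<rho> - \<sigma>))) (wD w g)"
proof -
  have "majorized a \<sigma> (mul_bound * (real (Suc p) * (mul_bound * (N / (\<rho> - \<sigma>))))) (wD w g)"
    unfolding wD_def[abs_def]
    by (rule majorized_linear)
       (use majorized_Dxp[OF assms(1-4)] assms linear_mul mul_bound(1) mul_bound(2)[of w] in auto)
  then show ?thesis by (simp add: step_bound_def power2_eq_square mult_ac)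
qed

lemma majorized_wD_funpow:
  assumes "majorized a \<rho> N g" "a \<in> Mp v p" "0 < \<tau>" "real j * \<tau> \<le> \<rho>" "norm w = 1"
  shows "majorized a (\<rho> - real j * \<tau>) (N * (step_bound / \<tau>) ^ j) ((wD w ^^ j) g)"
  using assms(4)
proof (induction j)
  case 0
  then show ?case using assms by simp
next
  case (Suc j)
  have *: "real j * \<tau> \<le> \<rho>" "0 \<le> \<rho> - real (Suc j) * \<tau>"
    using Suc.prems assms(3) by (auto simp: algebra_simps)
  have "majorized a (\<rho> - real (Suc j) * \<tau>)
     (N * (step_bound / \<tau>) ^ j * (step_bound / (\<rho> - real j * \<tau> - (\<rho> - real (Suc j) * \<tau>)))) (wD w ((wD w ^^ j) g))"
    by (rule majorized_wD[OF Suc.IH[OF *(1)] assms(2) *(2)]) (use assms in \<open>auto simp: algebra_simps\<close>)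
  moreover have "\<rho> - real j * \<tau> - (\<rho> - real (Suc j) * \<tau>) = \<tau>" by (simp add: algebra_simps)
  ultimately show ?case by (simp add: mult_ac)
qed

text \<open>Losing \<open>\<rho> / (2 n)\<close> of the radius at each of \<open>n\<close> steps costs \<open>n ^ n\<close>, which is
  at most \<open>exp 1 ^ n * fact n\<close>.\<close>

lemma factorial_growth_wD:
  assumes "majorized a \<rho> N g" "a \<in> Mp v p" "0 < \<rho>" "0 \<le> N" "norm w = 1"
  shows "factorial_growth a (\<rho> / 2) N (2 * step_bound * exp 1 / \<rho>) (\<lambda>n. (wD w ^^ n) g)"
  unfolding factorial_growth_def
proof
  fix n
  show "majorized a (\<rho> / 2) (N * (2 * step_bound * exp 1 / \<rho>) ^ n * fact n) ((wD w ^^ n) g)"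
  proof (cases "n = 0")
    case True
    then show ?thesis using assms by (auto intro: majorized_mono)
  next
    case False
    define \<tau> where "\<tau> = \<rho> / (2 * real n)"
    have \<tau>: "0 < \<tau>" "real n * \<tau> = \<rho> / 2" using False assms by (auto simp: \<tau>_def)
    have "majorized a (\<rho> - real n * \<tau>) (N * (step_bound / \<tau>) ^ n) ((wD w ^^ n) g)"
      using \<tau> assms by (intro majorized_wD_funpow) auto
    moreover have "N * (step_bound / \<tau>) ^ n \<le> N * (2 * step_bound * exp 1 / \<rho>) ^ n * fact n"
    proof -
      have "N * (step_bound / \<tau>) ^ n = N * (2 * step_bound / \<rho>) ^ n * real n ^ n"
        by (simp add: \<tau>_def power_mult_distrib power_divide)
      also have "\<dots> \<le> N * (2 * step_bound / \<rho>) ^ n * (exp 1 ^ n * fact n)"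
        using power_self_le_exp_fact[of n] assms step_bound_pos by (intro mult_left_mono) auto
      finally show ?thesis by (simp add: power_mult_distrib power_divide mult_ac)
    qed
    ultimately show ?thesis using \<tau> assms by (auto intro: majorized_mono)
  qed
qed

section \<open>Factorization of the Laplacian\<close>

text \<open>\<open>G s t\<close> stands for a second partial derivative. Moving \<open>w\<close>
  past \<open>v s\<close> costs a sign for \<open>s \<ge> 1\<close> but not for
  \<open>s = 0\<close>, so the left side is minus the conjugated Dirac operator applied to the Dirac
  operator. Mixed terms involving index 0 cancel by symmetry, the remaining ones by the Clifford
  relations.\<close>

lemma double_Dirac:
  assumes w: "w \<in> Sph v p m" and sym: "\<And>s t. s \<le> p \<Longrightarrow> t \<le> p \<Longrightarrow> G s t = G t s"
  shows "mul w (\<Sum>s\<le>p. mul (v s) (mul w (\<Sum>t\<le>p. mul (v t) (G s t)))) = - (\<Sum>s\<le>p. G s s)"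
proof -
  have split: "(\<Sum>s\<le>p. g s) = g 0 + (\<Sum>s\<in>{1..p}. g s)" for g :: "nat \<Rightarrow> 'a"
    by (simp add: sum.atLeast1_atMost_eq sum.atMost_shift lessThan_Suc_atMost)
  define E where "E s = (\<Sum>t\<le>p. mul (v t) (G s t))" for s
  define X where "X = (\<Sum>s\<in>{1..p}. \<Sum>t\<in>{1..p}. mul (v s) (mul (v t) (G s t)))"
  have E: "E s = G s 0 + (\<Sum>t\<in>{1..p}. mul (v t) (G s t))" for s
    unfolding E_def split by (simp add: v_zero mul_one)
  \<comment> \<open>By symmetry of \<open>G\<close> the sum \<open>X\<close> equals the one with the
    factors \<open>v s\<close> and \<open>v t\<close> exchanged, so \<open>X + X\<close> consists of
    symmetrized products and \<open>imag_mul_mul\<close> applies.\<close>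
  have "X = (\<Sum>s\<in>{1..p}. \<Sum>t\<in>{1..p}. mul (v t) (mul (v s) (G s t)))"
    unfolding X_def by (subst sum.swap) (intro sum.cong refl, simp add: sym)
  then have "X + X = (\<Sum>s\<in>{1..p}. \<Sum>t\<in>{1..p}.
      mul (v s) (mul (v t) (G s t)) + mul (v t) (mul (v s) (G s t)))"
    unfolding sum.distrib by (simp add: X_def)
  also have "\<dots> = (\<Sum>s\<in>{1..p}. \<Sum>t\<in>{1..p}. (- 2 * (v s \<bullet> v t)) *\<^sub>R G s t)"
    using pm by (intro sum.cong refl imag_mul_mul v_imag) auto
  also have "\<dots> = (\<Sum>s\<in>{1..p}. - 2 *\<^sub>R G s s)"
  proof (rule sum.cong[OF refl])
    fix s assume s: "s \<in> {1..p}"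
    have "(\<Sum>t\<in>{1..p}. (- 2 * (v s \<bullet> v t)) *\<^sub>R G s t) = (\<Sum>t\<in>{1..p}. if t = s then - 2 *\<^sub>R G s s else 0)"
      using s by (intro sum.cong) (auto simp: orthonormal)
    then show "(\<Sum>t\<in>{1..p}. (- 2 * (v s \<bullet> v t)) *\<^sub>R G s t) = - 2 *\<^sub>R G s s" using s by simp
  qed
  finally have "2 *\<^sub>R X = 2 *\<^sub>R (- (\<Sum>s\<in>{1..p}. G s s))"
    by (simp add: scaleR_2 sum_negf sum_subtractf)
  then have X: "X = - (\<Sum>s\<in>{1..p}. G s s)" by (simp only: scaleR_cancel_left) simp
  have "(\<Sum>s\<le>p. mul (v s) (mul w (E s))) = mul w (E 0) - mul w (\<Sum>s\<in>{1..p}. mul (v s) (E s))"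
    unfolding split by (simp add: v_zero mul_one Sph_v[OF w] sum_negf mul_sum)
  then have "mul w (\<Sum>s\<le>p. mul (v s) (mul w (E s))) = - E 0 + (\<Sum>s\<in>{1..p}. mul (v s) (E s))"
    by (simp add: linear_diff[OF linear_mul] Sph_square[OF w])
  also have "(\<Sum>s\<in>{1..p}. mul (v s) (E s)) = (\<Sum>t\<in>{1..p}. mul (v t) (G t 0)) + X"
    unfolding E X_def by (simp add: mul_simps mul_sum sum.distrib)
  also have "(\<Sum>t\<in>{1..p}. mul (v t) (G t 0)) = (\<Sum>t\<in>{1..p}. mul (v t) (G 0 t))"
    by (intro sum.cong refl) (simp add: sym)
  finally show ?thesis
    unfolding E_def[symmetric] split by (simp add: E[of 0] X)
qed

lemma locally_majorized_Dxp:
  assumes "locally_majorized \<Omega> g" "\<Omega> \<subseteq> Mp v p"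
  shows "locally_majorized \<Omega> (Dxp mul v p g)"
  unfolding Dxp_def[abs_def]
  by (intro locally_majorized_sum locally_majorized_linear[OF _ linear_mul] locally_majorized_dirderiv)
     (use assms in auto)

lemma locally_majorized_wD:
  assumes "locally_majorized \<Omega> g" "\<Omega> \<subseteq> Mp v p"
  shows "locally_majorized \<Omega> (wD w g)"
  unfolding wD_def[abs_def]
  by (intro locally_majorized_linear[OF _ linear_mul] locally_majorized_Dxp assms)

lemma locally_majorized_wD_funpow:
  assumes "locally_majorized \<Omega> g" "\<Omega> \<subseteq> Mp v p"
  shows "locally_majorized \<Omega> ((wD w ^^ n) g)"
  by (induction n) (use assms locally_majorized_wD in auto)

lemma wD_wD:
  assumes "locally_majorized \<Omega> g" "\<Omega> \<subseteq> Mp v p" "w \<in> Sph v p m" "x \<in> \<Omega>"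
  shows "wD w (wD w g) x = - Lapxp v p g x"
proof -
  define G where "G s t = dirderiv (dirderiv g (v t)) (v s) x" for s t
  have d: "dirderiv (wD w g) (v s) x = mul w (\<Sum>t\<le>p. mul (v t) (G s t))" if s: "s \<le> p" for s
  proof -
    have m: "locally_majorized \<Omega> (\<lambda>y. mul (v t) (dirderiv g (v t) y))" if "t \<in> {..p}" for t
      by (intro locally_majorized_linear[OF _ linear_mul] locally_majorized_dirderiv)
         (use assms that in auto)
    have "dirderiv (wD w g) (v s) x = mul w (dirderiv (Dxp mul v p g) (v s) x)"
      unfolding wD_def[abs_def]
      by (rule dirderiv_linear[OF locally_majorized_Dxp]) (use assms s linear_mul in auto)
    also have "dirderiv (Dxp mul v p g) (v s) x = (\<Sum>t\<le>p. dirderiv (\<lambda>y. mul (v t) (dirderiv g (v t) y)) (v s) x)"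
      unfolding Dxp_def[abs_def] by (rule dirderiv_sum[OF m assms(2,4) s])
    also have "\<dots> = (\<Sum>t\<le>p. mul (v t) (G s t))"
      unfolding G_def
      by (intro sum.cong refl dirderiv_linear[OF locally_majorized_dirderiv[OF assms(1,2)] assms(2,4) s linear_mul])
         auto
    finally show ?thesis .
  qed
  obtain \<rho> N where \<rho>: "0 < \<rho>" "majorized x \<rho> N g"
    using assms(1,4) by (rule locally_majorizedE)
  have sym: "G s t = G t s" if "s \<le> p" "t \<le> p" for s t
    unfolding G_def using majorized_dirderiv_commute[OF \<rho>(2), of x t s] \<rho>(1) center_in_polydisc assms that
    by auto
  have "wD w (wD w g) x = mul w (\<Sum>s\<le>p. mul (v s) (mul w (\<Sum>t\<le>p. mul (v t) (G s t))))"
    unfolding wD_def[of w "wD w g"] Dxp_def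
    by (intro arg_cong[where f = "mul w"] sum.cong refl) (simp add: d)
  also have "\<dots> = - (\<Sum>s\<le>p. G s s)" by (rule double_Dirac[OF assms(3) sym])
  finally show ?thesis by (simp add: Lapxp_def G_def)
qed

lemma negLap_pow_Suc: "negLap_pow v p (Suc k) g y = - Lapxp v p (negLap_pow v p k g) y"
  by (simp add: negLap_pow_def)

text \<open>\<open>wD_wD\<close> advances two powers at a time. The point is generalized in the
  induction because the Laplacian at \<open>x\<close> consumes the previous equality on all of
  \<Omega>.\<close>

lemma negLap_pow_eq_wD:
  assumes "locally_majorized \<Omega> g" "openin (top_of_set (Mp v p)) \<Omega>" "w \<in> Sph v p m" "x \<in> \<Omega>"
  shows "negLap_pow v p k g x = (wD w ^^ (2 * k)) g x"
  using assms(4)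
proof (induction k arbitrary: x)
  case 0
  then show ?case by (simp add: negLap_pow_def)
next
  case (Suc k)
  have \<Omega>: "\<Omega> \<subseteq> Mp v p" using openin_imp_subset[OF assms(2)] .
  have "negLap_pow v p (Suc k) g x = - Lapxp v p ((wD w ^^ (2 * k)) g) x"
    unfolding negLap_pow_Suc using Lapxp_cong_on[OF assms(2) Suc.prems Suc.IH] by simp
  also have "\<dots> = wD w (wD w ((wD w ^^ (2 * k)) g)) x"
    by (rule wD_wD[symmetric, OF locally_majorized_wD_funpow[OF assms(1) \<Omega>] \<Omega> assms(3) Suc.prems])
  finally show ?case by simp
qed

text \<open>Left multiplication by a fixed \<open>w\<close> is linear and commutes with the
  Laplacian. The even iterates of \<open>wD\<close> stand in for the powers of the Laplacian on
  \<Omega>, because their local majorization is already known.\<close>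

lemma negLap_pow_mul:
  assumes "locally_majorized \<Omega> g" "openin (top_of_set (Mp v p)) \<Omega>" "w \<in> Sph v p m" "x \<in> \<Omega>"
  shows "negLap_pow v p k (\<lambda>y. mul w (g y)) x = mul w (negLap_pow v p k g x)"
  using assms(4)
proof (induction k arbitrary: x)
  case 0
  then show ?case by (simp add: negLap_pow_def)
next
  case (Suc k)
  have \<Omega>: "\<Omega> \<subseteq> Mp v p" using openin_imp_subset[OF assms(2)] .
  let ?h = "(wD w ^^ (2 * k)) g"
  have h: "negLap_pow v p k g y = ?h y" if "y \<in> \<Omega>" for y
    by (rule negLap_pow_eq_wD[OF assms(1-3) that])
  have "negLap_pow v p (Suc k) (\<lambda>y. mul w (g y)) x = - Lapxp v p (\<lambda>y. mul w (?h y)) x"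
    unfolding negLap_pow_Suc
    by (intro arg_cong[where f = uminus] Lapxp_cong_on[OF assms(2) Suc.prems]) (simp only: Suc.IH h)
  also have "\<dots> = mul w (- Lapxp v p ?h x)"
    using Lapxp_linear[OF assms(2) locally_majorized_wD_funpow[OF assms(1) \<Omega>] Suc.prems linear_mul]
    by (simp add: mul_simps)
  also have "- Lapxp v p ?h x = negLap_pow v p (Suc k) g x"
    unfolding negLap_pow_Suc using Lapxp_cong_on[OF assms(2) Suc.prems h] by simp
  finally show ?case .
qed

text \<open>Splitting off the innermost \<open>wD\<close> leaves an even iterate, that is, a power
  of the negative Laplacian, through which the constant factor \<open>w\<close> can be pulled
  out.\<close>

lemma wD_odd:
  assumes "locally_majorized \<Omega> g" "openin (top_of_set (Mp v p)) \<Omega>" "w \<in> Sph v p m" "x \<in> \<Omega>"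
  shows "(wD w ^^ (2 * k + 1)) g x = mul w (negLap_pow v p k (Dxp mul v p g) x)"
proof -
  have \<Omega>: "\<Omega> \<subseteq> Mp v p" using openin_imp_subset[OF assms(2)] .
  have "(wD w ^^ (2 * k + 1)) g x = (wD w ^^ (2 * k)) (wD w g) x"
    by (simp add: funpow_swap1)
  also have "\<dots> = negLap_pow v p k (wD w g) x"
    by (rule negLap_pow_eq_wD[symmetric, OF locally_majorized_wD[OF assms(1) \<Omega>] assms(2-4)])
  also have "\<dots> = mul w (negLap_pow v p k (Dxp mul v p g) x)"
    unfolding wD_def[abs_def] by (rule negLap_pow_mul[OF locally_majorized_Dxp[OF assms(1) \<Omega>] assms(2-4)])
  finally show ?thesis .
qed

section \<open>The Cauchy--Kovalevskaya extension\<close>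

abbreviation CKs :: "'a \<Rightarrow> ('a \<Rightarrow> 'a) \<Rightarrow> 'a \<Rightarrow> 'a" where
  "CKs w f \<equiv> normal_series w (\<lambda>n. (wD w ^^ n) f)"

abbreviation CKs_normal :: "'a \<Rightarrow> ('a \<Rightarrow> 'a) \<Rightarrow> 'a \<Rightarrow> 'a" where
  "CKs_normal w f \<equiv> normal_series w (\<lambda>n. (wD w ^^ Suc n) f)"

abbreviation CKs_tangential :: "'a \<Rightarrow> ('a \<Rightarrow> 'a) \<Rightarrow> nat \<Rightarrow> 'a \<Rightarrow> 'a" where
  "CKs_tangential w f s \<equiv> normal_series w (\<lambda>n. dirderiv ((wD w ^^ n) f) (v s))"

text \<open>All that monogenicity needs at one point for one \<open>w\<close>. The derivative is
  ambient, so that slice derivatives and \<open>dirderiv\<close> both follow from it; the last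
  clause is the Cauchy--Kovalevskaya equation for the sum.\<close>

definition CK_regular :: "'a \<Rightarrow> ('a \<Rightarrow> 'a) \<Rightarrow> 'a \<Rightarrow> bool" where
  "CK_regular w f x \<longleftrightarrow>
     summable (\<lambda>n. norm (((x \<bullet> w) ^ n / fact n) *\<^sub>R (wD w ^^ n) f (xpart v p x))) \<and>
     (CKs w f has_derivative
        (\<lambda>h. (h \<bullet> w) *\<^sub>R CKs_normal w f x + (\<Sum>s\<le>p. (h \<bullet> v s) *\<^sub>R CKs_tangential w f s x))) (at x) \<and>
     isCont (CKs_normal w f) x \<and> (\<forall>s\<le>p. isCont (CKs_tangential w f s) x) \<and>
     CKs_normal w f x = mul w (\<Sum>s\<le>p. mul (v s) (CKs_tangential w f s x))"

lemma CK_regular_near: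
  assumes "majorized a \<rho> N f" "a \<in> Mp v p" "0 < \<rho>"
  obtains \<epsilon> where "0 < \<epsilon>" 
    "\<And>w x. w \<in> Sph v p m \<Longrightarrow> x \<in> polydisc a \<epsilon> \<Longrightarrow> \<bar>x \<bullet> w\<bar> < \<epsilon> \<Longrightarrow> CK_regular w f x"
proof -
  define K where "K = 2 * step_bound * exp 1 / \<rho>"
  \<comment> \<open>The iterates are controlled at radius \<open>\<rho> / 2\<close>, and their
    tangential derivatives halve it again. The shifted series has growth constant
    \<open>2 * K\<close>, and differentiating it termwise, which yields its continuity, requires
    half of its radius \<open>1 / (2 * K)\<close>.\<close>
  define \<epsilon> where "\<epsilon> = min (\<rho> / 4) (1 / (4 * K))"
  have K: "0 < K" using step_bound_pos assms by (simp add: K_def)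
  have N: "0 \<le> N"
    using majorized_bound[OF assms(1) _ assms(2) center_in_polydisc] assms(3) norm_ge_zero[of "f a"]
    by linarith
  have reg: "CK_regular w f x" if w: "w \<in> Sph v p m" and x: "x \<in> polydisc a \<epsilon>" "\<bar>x \<bullet> w\<bar> < \<epsilon>" for w x
  proof -
    let ?H = "\<lambda>n. (wD w ^^ n) f"
    have H: "factorial_growth a (\<rho> / 2) N K ?H"
      unfolding K_def using assms N Sph_norm[OF w] by (intro factorial_growth_wD) auto
    have HS: "factorial_growth a (\<rho> / 2) (N * K) (2 * K) (\<lambda>n. ?H (Suc n))"
      using H assms K N by (intro factorial_growth_Suc) auto
    have HD: "factorial_growth a (\<rho> / 4) (N / (\<rho> / 2 - \<rho> / 4)) K (\<lambda>n. dirderiv (?H n) (v s))" if "s \<le> p" for s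
      using that assms by (intro factorial_growth_dirderiv[OF H]) auto
    have x4: "x \<in> polydisc a (\<rho> / 4)"
      using polydisc_mono[of \<epsilon> "\<rho> / 4" a] x(1) unfolding \<epsilon>_def by (meson min.cobounded1 subsetD)
    then have x2: "x \<in> polydisc a (\<rho> / 2)"
      using polydisc_mono[of "\<rho> / 4" "\<rho> / 2" a] assms(3) by auto
    have r4: "\<bar>x \<bullet> w\<bar> < 1 / (2 * (2 * K))" using x(2) by (simp add: \<epsilon>_def)
    also have "\<dots> \<le> 1 / (2 * K)" using K by (intro divide_left_mono) auto
    finally have r2: "\<bar>x \<bullet> w\<bar> < 1 / (2 * K)" .
    also have "\<dots> \<le> 1 / K" using K by (intro divide_left_mono) auto
    finally have r1: "\<bar>x \<bullet> w\<bar> < 1 / K" .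
    let ?t = "\<lambda>g n. ((x \<bullet> w) ^ n / fact n) *\<^sub>R g n (xpart v p x)"
    have D: "(\<lambda>n. ?t (\<lambda>n. dirderiv (?H n) (v s)) n) sums CKs_tangential w f s x" if "s \<le> p" for s
      unfolding normal_series_def
      by (intro summable_sums summable_norm_cancel[OF normal_series_abs_summable[OF HD[OF that] _ x4 r1 K]])
         (use assms in auto)
    \<comment> \<open>Applying \<open>w D\<close> to the n-th coefficient gives the next one, so the
      termwise image of the series is the shifted series.\<close>
    have "(\<lambda>n. mul w (\<Sum>s\<le>p. mul (v s) (?t (\<lambda>n. dirderiv (?H n) (v s)) n))) sums
        mul w (\<Sum>s\<le>p. mul (v s) (CKs_tangential w f s x))"
      by (intro bounded_linear.sums[OF bounded_linear_mul] sums_sum D) auto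
    then have "mul w (\<Sum>s\<le>p. mul (v s) (CKs_tangential w f s x)) = CKs_normal w f x"
      unfolding normal_series_def[of w "\<lambda>n. ?H (Suc n)"]
      by (simp add: sums_iff wD_def Dxp_def mul_simps scaleR_sum_right[symmetric])
    then show ?thesis
      unfolding CK_regular_def
      using normal_series_abs_summable[OF H _ x2 r1 K] assms
        normal_series_has_derivative[OF H assms(2) N x2 K r2 Sph_norm[OF w]]
        isCont_normal_series[OF HS assms(2) _ x2 _ r4 Sph_norm[OF w]] N K
        isCont_normal_series[OF HD assms(2) _ x4 K r2 Sph_norm[OF w]]
      by auto
  qed
  have "0 < \<epsilon>" using K assms by (simp add: \<epsilon>_def)
  then show ?thesis using reg that by blast
qed

section \<open>Slice planes and the splitting of \<open>Mspace\<close>\<close>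

lemma Mp_inner_Sph: "y \<in> Mp v p \<Longrightarrow> w \<in> Sph v p m \<Longrightarrow> y \<bullet> w = 0"
  unfolding Mp_def
  by (induction rule: span_induct)
     (auto simp: subspace_def inner_add_left inner_commute[of "v _"] Sph_inner)

lemma xpart_Sph: "w \<in> Sph v p m \<Longrightarrow> xpart v p w = 0"
  by (simp add: xpart_def Sph_inner)

lemma linear_xqpart: "linear (xqpart v p m)"
  unfolding xqpart_def by (intro linear_compose_sum linearI ballI) (auto simp: inner_add_left algebra_simps)

lemma xpart_add_xqpart: "x \<in> Mspace v m \<Longrightarrow> xpart v p x + xqpart v p m x = x"
proof -
  assume x: "x \<in> Mspace v m"
  interpret full: orthonormal_frame v m
    by unfold_locales (use bas in \<open>auto simp: basis_setup_def\<close>)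
  have "{..m} = {..p} \<union> {p+1..m}" using pm by auto
  then have "xpart v m x = xpart v p x + xqpart v p m x"
    unfolding xpart_def xqpart_def by (auto intro: sum.union_disjoint)
  then show ?thesis using full.xpart_Mp[of x] x by (simp add: Mspace_def Mp_def)
qed

lemma Mp_subset_Mspace: "Mp v p \<subseteq> Mspace v m"
  unfolding Mp_def Mspace_def using pm by (intro span_mono image_mono) auto

lemma Mq_subset_Mspace: "Mq v p m \<subseteq> Mspace v m"
  unfolding Mq_def Mspace_def by (intro span_mono image_mono) auto

lemma xqpart_Mp: "y \<in> Mp v p \<Longrightarrow> xqpart v p m y = 0"
  using xpart_add_xqpart[of y] Mp_subset_Mspace xpart_Mp[of y] by auto

lemma xqpart_Sph: "w \<in> Sph v p m \<Longrightarrow> xqpart v p m w = w"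
  using xpart_add_xqpart[of w] Mq_subset_Mspace xpart_Sph[of w] by (auto simp: Sph_def)

lemma xqpart_in_Mq: "xqpart v p m x \<in> Mq v p m"
  unfolding xqpart_def Mq_def by (intro span_sum span_scale span_base) auto

lemma subspace_plane: "subspace (plane v p w)"
  unfolding plane_def
proof (rule subspaceI)
  show "0 \<in> {a + r *\<^sub>R w |a r. a \<in> Mp v p}"
    using subspace_0[OF subspace_Mp] by (force intro: exI[of _ 0])
next
  fix x y assume "x \<in> {a + r *\<^sub>R w |a r. a \<in> Mp v p}" "y \<in> {a + r *\<^sub>R w |a r. a \<in> Mp v p}"
  then obtain a r b q where "x = a + r *\<^sub>R w" "y = b + q *\<^sub>R w" "a \<in> Mp v p" "b \<in> Mp v p" by blast
  then have "x + y = (a + b) + (r + q) *\<^sub>R w" "a + b \<in> Mp v p"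
    using subspace_add[OF subspace_Mp] by (auto simp: algebra_simps)
  then show "x + y \<in> {a + r *\<^sub>R w |a r. a \<in> Mp v p}" by blast
next
  fix c x assume "x \<in> {a + r *\<^sub>R w |a r. a \<in> Mp v p}"
  then obtain a r where "x = a + r *\<^sub>R w" "a \<in> Mp v p" by blast
  then have "c *\<^sub>R x = c *\<^sub>R a + (c * r) *\<^sub>R w" "c *\<^sub>R a \<in> Mp v p"
    using subspace_scale[OF subspace_Mp] by (auto simp: algebra_simps)
  then show "c *\<^sub>R x \<in> {a + r *\<^sub>R w |a r. a \<in> Mp v p}" by blast
qed

lemma plane_subset_Mspace: "w \<in> Sph v p m \<Longrightarrow> plane v p w \<subseteq> Mspace v m"
proof
  fix x assume w: "w \<in> Sph v p m" and "x \<in> plane v p w"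
  then obtain a r where x: "x = a + r *\<^sub>R w" "a \<in> Mp v p" unfolding plane_def by blast
  have "subspace (Mspace v m)" by (simp add: Mspace_def)
  moreover have "w \<in> Mspace v m" "a \<in> Mspace v m"
    using w x Mq_subset_Mspace Mp_subset_Mspace by (auto simp: Sph_def)
  ultimately show "x \<in> Mspace v m" unfolding x by (intro subspace_add subspace_scale)
qed

lemma Mp_subset_plane: "Mp v p \<subseteq> plane v p w"
  unfolding plane_def by (force intro: exI[of _ 0])

lemma Sph_in_plane: "w \<in> plane v p w"
proof -
  have "w = 0 + 1 *\<^sub>R w" by simp
  then show ?thesis unfolding plane_def using subspace_0[OF subspace_Mp] by blast
qed

text \<open>The plane contains both half-planes, hence the absolute value: where
  \<open>x \<bullet> w\<close> is negative, the unit direction of x_q is \<open>- w\<close>.\<close>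

lemma plane_decompose:
  assumes "w \<in> Sph v p m" "x \<in> plane v p w"
  shows "xqpart v p m x = (x \<bullet> w) *\<^sub>R w" "norm (xqpart v p m x) = \<bar>x \<bullet> w\<bar>"
proof -
  obtain a r where x: "x = a + r *\<^sub>R w" "a \<in> Mp v p" using assms(2) unfolding plane_def by blast
  have "x \<bullet> w = r" using x Mp_inner_Sph[OF x(2) assms(1)] Sph_norm[OF assms(1)]
    by (simp add: inner_add_left dot_square_norm)
  moreover have "xqpart v p m x = r *\<^sub>R w"
    using x by (simp add: linear_add[OF linear_xqpart] linear_cmul[OF linear_xqpart] xqpart_Mp xqpart_Sph[OF assms(1)])
  ultimately show "xqpart v p m x = (x \<bullet> w) *\<^sub>R w" "norm (xqpart v p m x) = \<bar>x \<bullet> w\<bar>"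
    using Sph_norm[OF assms(1)] by auto
qed

lemma v_m_Sph: "v m \<in> Sph v p m"
proof -
  have "v m \<bullet> v m = 1" using bas by (auto simp: basis_setup_def)
  then show ?thesis
    using pm unfolding Sph_def Mq_def by (auto simp: norm_eq_sqrt_inner intro: span_base)
qed

text \<open>A point of \<open>Mp v p\<close> lies in every slice plane, and \<open>v m\<close> is a
  witness that some \<open>w\<close> exists; for any other point, x_q is normalized.\<close>

lemma Mspace_in_plane:
  assumes "x \<in> Mspace v m"
  obtains w where "w \<in> Sph v p m" "x \<in> plane v p w"
proof (cases "xqpart v p m x = 0")
  case True
  then have "x = xpart v p x" using xpart_add_xqpart[OF assms] by simp
  then have "x \<in> Mp v p" using xpart_in_Mp by metis
  then show ?thesis using that v_m_Sph Mp_subset_plane by blast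
next
  case False
  define w where "w = (1 / norm (xqpart v p m x)) *\<^sub>R xqpart v p m x"
  have "w \<in> Sph v p m"
    using False xqpart_in_Mq unfolding w_def Sph_def by (auto simp: Mq_def intro: span_scale)
  moreover have "x = xpart v p x + norm (xqpart v p m x) *\<^sub>R w"
    using False xpart_add_xqpart[OF assms] by (simp add: w_def)
  then have "x \<in> plane v p w" unfolding plane_def using xpart_in_Mp by blast
  ultimately show ?thesis using that by blast
qed

section \<open>Identification with the two explicit series\<close>

text \<open>Where \<open>x \<bullet> w\<close> is negative, \<open>CK\<close> works with the
  direction \<open>- w\<close> and the absolute value of the coordinate. Even terms do not notice;
  in the odd part the powers and the direction each contribute a factor \<open>sgn\<close>, and
  these cancel.\<close>

lemma CK_eq_CKs:
  assumes f: "locally_majorized \<Omega> f" and \<Omega>: "openin (top_of_set (Mp v p)) \<Omega>"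
    and w: "w \<in> Sph v p m" and x: "x \<in> plane v p w" "xpart v p x \<in> \<Omega>" and reg: "CK_regular w f x"
  shows "summable (CK_even v p m f x)" "summable (CK_odd mul v p m f x)"
    "CK mul v p m f x = CKs w f x"
proof -
  let ?r = "x \<bullet> w"
  let ?y = "xpart v p x"
  let ?t = "\<lambda>n. (?r ^ n / fact n) *\<^sub>R (wD w ^^ n) f ?y"
  have abs: "summable (\<lambda>n. norm (?t n))" using reg by (simp add: CK_regular_def)
  have even: "CK_even v p m f x k = ?t (2 * k)" for k
    unfolding CK_even_def plane_decompose(2)[OF w x(1)] negLap_pow_eq_wD[OF f \<Omega> w x(2)]
    by (simp add: power_even_abs)
  \<comment> \<open>\<open>wD_odd\<close> carries \<open>w\<close> in front of the wanted
    coefficient; a second multiplication by \<open>w\<close> removes it, at the price of the minus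
    sign.\<close>
  have odd: "CK_odd mul v p m f x k = (- sgn ?r) *\<^sub>R mul w (?t (2 * k + 1))" for k
  proof -
    have "sgn ?r * ?r ^ (2 * k + 1) = (sgn ?r * ?r) * \<bar>?r\<bar> ^ (2 * k)"
      by (simp add: power_even_abs)
    also have "\<dots> = \<bar>?r\<bar> ^ (2 * k + 1)" by (simp add: abs_sgn mult.commute)
    finally have r: "\<bar>?r\<bar> ^ (2 * k + 1) = sgn ?r * ?r ^ (2 * k + 1)" ..
    show ?thesis
      unfolding CK_odd_def plane_decompose(2)[OF w x(1)] wD_odd[OF f \<Omega> w x(2)] r
      by (simp add: mul_simps Sph_square[OF w])
  qed
  have "summable (\<lambda>k. norm (?t (2 * k)))"
    using summable_reindex[OF abs, of "\<lambda>k. 2 * k"] by (simp add: inj_def o_def)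
  then have e: "summable (\<lambda>k. ?t (2 * k))" by (rule summable_norm_cancel)
  then show "summable (CK_even v p m f x)" unfolding even[abs_def] .
  have "summable (\<lambda>k. norm (?t (2 * k + 1)))"
    using summable_reindex[OF abs, of "\<lambda>k. 2 * k + 1"] by (simp add: inj_def o_def)
  then have o: "summable (\<lambda>k. ?t (2 * k + 1))" by (rule summable_norm_cancel)
  have odd_sums: "CK_odd mul v p m f x sums ((- sgn ?r) *\<^sub>R mul w (\<Sum>k. ?t (2 * k + 1)))"
    unfolding odd[abs_def]
    by (intro sums_scaleR_right bounded_linear.sums[OF bounded_linear_mul] summable_sums o)
  then show "summable (CK_odd mul v p m f x)" by (rule sums_summable)
  have "(\<lambda>n. if even n then ?t (2 * (n div 2)) else ?t (2 * (n div 2) + 1)) sums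
      ((\<Sum>k. ?t (2 * k)) + (\<Sum>k. ?t (2 * k + 1)))"
    by (intro sums_interleave summable_sums e o)
  then have "?t sums ((\<Sum>k. ?t (2 * k)) + (\<Sum>k. ?t (2 * k + 1)))"
    by (rule back_subst[of "\<lambda>f. f sums _"]) (auto elim!: oddE)
  then have CKs: "CKs w f x = (\<Sum>k. ?t (2 * k)) + (\<Sum>k. ?t (2 * k + 1))"
    by (simp add: normal_series_def sums_iff)
  have unit: "(1 / norm (xqpart v p m x)) *\<^sub>R xqpart v p m x = sgn ?r *\<^sub>R w"
    unfolding plane_decompose[OF w x(1)] by (simp add: real_sgn_eq Sph_norm[OF w])
  have "mul ((1 / norm (xqpart v p m x)) *\<^sub>R xqpart v p m x) (\<Sum>k. CK_odd mul v p m f x k) =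
      (sgn ?r * sgn ?r) *\<^sub>R (\<Sum>k. ?t (2 * k + 1))"
    unfolding sums_unique[OF odd_sums, symmetric] unit
    by (simp only: mul_simps Sph_square[OF w] scaleR_scaleR scaleR_minus_left scaleR_minus_right minus_minus)
  also have "\<dots> = (\<Sum>k. ?t (2 * k + 1))"
    \<comment> \<open>For \<open>?r = 0\<close> the scalar is 0 instead of 1, but then every odd
      term vanishes as well.\<close>
    by (cases "?r = 0") (simp_all add: sgn_if)
  finally show "CK mul v p m f x = CKs w f x"
    unfolding CK_def CKs even by simp
qed

section \<open>The domain of convergence\<close>

text \<open>A union of cylinders around the points of \<Omega>: \<open>polydisc\<close> restricts
  only the component in \<open>Mp v p\<close>, the last condition only x_q. As x_q enters through
  its norm alone, p-symmetry is built in.\<close>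

definition CK_domain :: "('a \<Rightarrow> real) \<Rightarrow> 'a set \<Rightarrow> 'a set" where
  "CK_domain \<epsilon> \<Omega> = {x \<in> Mspace v m. \<exists>a\<in>\<Omega>. x \<in> polydisc a (\<epsilon> a) \<and> norm (xqpart v p m x) < \<epsilon> a}"

lemma CK_domain_open:
  obtains U where "open U" "CK_domain \<epsilon> \<Omega> = Mspace v m \<inter> U"
proof -
  have "continuous_on UNIV (xqpart v p m)"
    using linear_xqpart linear_continuous_on linear_linear by blast
  then have "open {x. norm (xqpart v p m x) < \<epsilon> a}" for a
    by (intro open_Collect_less continuous_intros)
  then have "open (\<Union>a\<in>\<Omega>. polydisc a (\<epsilon> a) \<inter> {x. norm (xqpart v p m x) < \<epsilon> a})"
    by (intro open_UN ballI open_Int open_polydisc)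
  then show ?thesis by (rule that) (auto simp: CK_domain_def)
qed

lemma subset_CK_domain:
  assumes "\<Omega> \<subseteq> Mp v p" "\<And>a. a \<in> \<Omega> \<Longrightarrow> 0 < \<epsilon> a"
  shows "\<Omega> \<subseteq> CK_domain \<epsilon> \<Omega>"
  using assms Mp_subset_Mspace center_in_polydisc xqpart_Mp unfolding CK_domain_def by fastforce

lemma xpart_CK_domain:
  assumes "\<And>a. a \<in> \<Omega> \<Longrightarrow> Mp v p \<inter> polydisc a (\<epsilon> a) \<subseteq> \<Omega>" "x \<in> CK_domain \<epsilon> \<Omega>"
  shows "xpart v p x \<in> \<Omega>"
  using assms unfolding CK_domain_def by force

lemma CK_domain_subset_cyl_ext:
  assumes "\<And>a. a \<in> \<Omega> \<Longrightarrow> Mp v p \<inter> polydisc a (\<epsilon> a) \<subseteq> \<Omega>"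
  shows "CK_domain \<epsilon> \<Omega> \<subseteq> cyl_ext v p m \<Omega>"
proof
  fix x assume x: "x \<in> CK_domain \<epsilon> \<Omega>"
  then have "x = xpart v p x + xqpart v p m x"
    using xpart_add_xqpart by (simp add: CK_domain_def)
  then show "x \<in> cyl_ext v p m \<Omega>"
    unfolding cyl_ext_def using xpart_CK_domain[OF assms x] xqpart_in_Mq by blast
qed

lemma p_symmetric_CK_domain: "p_symmetric v p m (CK_domain \<epsilon> \<Omega>)"
  unfolding p_symmetric_def
proof (intro ballI allI impI)
  fix a r w e
  assume *: "a \<in> Mp v p" "w \<in> Sph v p m" "e \<in> Sph v p m" "a + r *\<^sub>R w \<in> CK_domain \<epsilon> \<Omega>"
  have n: "norm (xqpart v p m (a + r *\<^sub>R u)) = \<bar>r\<bar>" if "u \<in> Sph v p m" for u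
    using that * by (simp add: linear_add[OF linear_xqpart] linear_cmul[OF linear_xqpart]
        xqpart_Mp xqpart_Sph Sph_norm)
  have d: "a + r *\<^sub>R u \<in> polydisc b \<delta> \<longleftrightarrow> a \<in> polydisc b \<delta>" if "u \<in> Sph v p m" for u b \<delta>
    using that by (simp add: polydisc_def inner_diff_left inner_add_left Sph_inner)
  have "a + r *\<^sub>R e \<in> plane v p e" unfolding plane_def using * by blast
  then have "a + r *\<^sub>R e \<in> Mspace v m" using plane_subset_Mspace[OF *(3)] by blast
  then show "a + r *\<^sub>R e \<in> CK_domain \<epsilon> \<Omega>"
    using * n d by (auto simp: CK_domain_def)
qed

text \<open>Each piece is convex and contains its own centre; the connected set \<Omega>, which lies
  in every slice plane, passes through all centres and links the pieces.\<close>

lemma connected_slice_CK_domain: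
  assumes w: "w \<in> Sph v p m" and \<Omega>: "\<Omega> \<subseteq> Mp v p" "connected \<Omega>" and \<epsilon>: "\<And>a. a \<in> \<Omega> \<Longrightarrow> 0 < \<epsilon> a"
  shows "connected (slice v p (CK_domain \<epsilon> \<Omega>) w)"
proof -
  let ?C = "\<lambda>a. plane v p w \<inter> polydisc a (\<epsilon> a) \<inter> {x. \<bar>x \<bullet> w\<bar> < \<epsilon> a}"
  have "slice v p (CK_domain \<epsilon> \<Omega>) w = (\<Union>a\<in>\<Omega>. ?C a)"
    using plane_decompose(2)[OF w] plane_subset_Mspace[OF w]
    unfolding slice_def CK_domain_def by auto
  moreover have sub: "a \<in> ?C a" if "a \<in> \<Omega>" for a
    using that \<Omega> \<epsilon> Mp_subset_plane center_in_polydisc Mp_inner_Sph[OF _ w] by auto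
  ultimately have eq: "slice v p (CK_domain \<epsilon> \<Omega>) w = \<Omega> \<union> \<Union> (?C ` \<Omega>)" by blast
  have "{x. \<bar>x \<bullet> w\<bar> < d} = {x. inner w x < d} \<inter> {x. inner w x > - d}" for d
    by (auto simp: inner_commute)
  then have "convex (?C a)" for a
    by (simp only:) (intro convex_Int convex_polydisc convex_halfspace_lt convex_halfspace_gt
        subspace_imp_convex subspace_plane)
  then have "connected (?C a)" for a by (rule convex_connected)
  then show ?thesis
    unfolding eq using \<Omega>(2) sub by (intro connected_Un_UN) auto
qed

lemma slice_domain_CK_domain:
  assumes \<Omega>: "\<Omega> \<subseteq> Mp v p" "connected \<Omega>" "\<Omega> \<noteq> {}" and \<epsilon>: "\<And>a. a \<in> \<Omega> \<Longrightarrow> 0 < \<epsilon> a"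
  shows "slice_domain v p m (CK_domain \<epsilon> \<Omega>)"
proof -
  obtain U where U: "open U" "CK_domain \<epsilon> \<Omega> = Mspace v m \<inter> U" using CK_domain_open by blast
  have sub: "\<Omega> \<subseteq> CK_domain \<epsilon> \<Omega>" by (rule subset_CK_domain[OF \<Omega>(1) \<epsilon>])
  have "openin (top_of_set (plane v p w)) (slice v p (CK_domain \<epsilon> \<Omega>) w)" if w: "w \<in> Sph v p m" for w
  proof -
    have "slice v p (CK_domain \<epsilon> \<Omega>) w = plane v p w \<inter> U"
      using U(2) plane_subset_Mspace[OF w] by (auto simp: slice_def)
    then show ?thesis using U(1) by (simp add: openin_open_Int)
  qed
  moreover have "slice v p (CK_domain \<epsilon> \<Omega>) w \<noteq> {}" for w
    using \<Omega> sub Mp_subset_plane by (fastforce simp: slice_def)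
  moreover have "openin (top_of_set (Mspace v m)) (CK_domain \<epsilon> \<Omega>)"
    using U by (simp add: openin_open_Int)
  moreover have "connected (slice v p (CK_domain \<epsilon> \<Omega>) w)" if "w \<in> Sph v p m" for w
    by (rule connected_slice_CK_domain[OF that \<Omega>(1,2) \<epsilon>])
  moreover have "CK_domain \<epsilon> \<Omega> \<inter> Mp v p \<noteq> {}" "CK_domain \<epsilon> \<Omega> \<subseteq> Mspace v m"
    using \<Omega> sub U(2) by blast+
  ultimately show ?thesis
    unfolding slice_domain_def by blast
qed

section \<open>Monogenicity and the initial values\<close>

text \<open>\<open>CK\<close> is identified with \<open>CKs w f\<close> on the plane of
  \<open>w\<close> only, since elsewhere it uses another direction. The ambient derivative of
  \<open>CKs w f\<close> is therefore used only within the slice and along vectors of the plane,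
  whose lines remain in the slice as long as they remain in \<open>U\<close>.\<close>

lemma CK_monogenic:
  assumes f: "locally_majorized \<Omega> f" and \<Omega>: "openin (top_of_set (Mp v p)) \<Omega>"
    and U: "open U" "W = Mspace v m \<inter> U" and xp: "\<And>x. x \<in> W \<Longrightarrow> xpart v p x \<in> \<Omega>"
    and reg: "\<And>w x. w \<in> Sph v p m \<Longrightarrow> x \<in> slice v p W w \<Longrightarrow> CK_regular w f x"
  shows "gps_monogenic mul v p m W (CK mul v p m f)"
  unfolding gps_monogenic_def
proof (intro ballI conjI)
  fix w assume w: "w \<in> Sph v p m"
  let ?S = "slice v p W w"
  let ?f' = "\<lambda>x h. (h \<bullet> w) *\<^sub>R CKs_normal w f x + (\<Sum>s\<le>p. (h \<bullet> v s) *\<^sub>R CKs_tangential w f s x)"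
  have CK: "CK mul v p m f x = CKs w f x" if "x \<in> ?S" for x
    using that xp reg[OF w that] by (intro CK_eq_CKs[OF f \<Omega> w]) (auto simp: slice_def)
  have deriv: "(CKs w f has_derivative ?f' x) (at x)" if "x \<in> ?S" for x
    using reg[OF w that] unfolding CK_regular_def by blast
  show "C1_on ?S (CK mul v p m f)"
    unfolding C1_on_def
  proof (intro exI conjI ballI)
    have F: "blinfun_apply (Blinfun (?f' x)) = ?f' x" if "x \<in> ?S" for x
      using has_derivative_bounded_linear[OF deriv[OF that]] by (rule bounded_linear_Blinfun_apply)
    show "continuous_on ?S (\<lambda>x. Blinfun (?f' x))"
    proof (rule continuous_on_blinfun_componentwise)
      fix i :: 'a
      have "continuous_on ?S (CKs_normal w f)" "\<And>s. s \<le> p \<Longrightarrow> continuous_on ?S (CKs_tangential w f s)"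
        using reg[OF w] unfolding CK_regular_def by (blast intro: continuous_at_imp_continuous_on)+
      then have "continuous_on ?S (\<lambda>x. ?f' x i)" by (intro continuous_intros) auto
      then show "continuous_on ?S (\<lambda>x. blinfun_apply (Blinfun (?f' x)) i)"
        by (rule continuous_on_eq) (simp only: F)
    qed
    fix x assume x: "x \<in> ?S"
    show "(CK mul v p m f has_derivative blinfun_apply (Blinfun (?f' x))) (at x within ?S)"
      unfolding F[OF x]
      by (rule has_derivative_transform[OF x CK has_derivative_at_withinI[OF deriv[OF x]]])
  qed
  fix y assume y: "y \<in> ?S"
  have dir: "dirderiv (CK mul v p m f) u y = ?f' y u" if u: "u \<in> plane v p w" for u
  proof -
    have "dirderiv (CK mul v p m f) u y = dirderiv (CKs w f) u y"
    proof (rule dirderiv_cong[OF U(1)])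
      show "y \<in> U" using y U(2) by (simp add: slice_def)
      fix t assume t: "y + t *\<^sub>R u \<in> U"
      have "y + t *\<^sub>R u \<in> plane v p w"
        using y u subspace_plane[of w] by (auto simp: slice_def intro: subspace_add subspace_scale)
      then have "y + t *\<^sub>R u \<in> ?S"
        using t U(2) plane_subset_Mspace[OF w] by (auto simp: slice_def)
      then show "CK mul v p m f (y + t *\<^sub>R u) = CKs w f (y + t *\<^sub>R u)" by (rule CK)
    qed
    then show ?thesis using dirderiv_eq[OF deriv[OF y]] by simp
  qed
  have dv: "dirderiv (CK mul v p m f) (v s) y = CKs_tangential w f s y" if s: "s \<le> p" for s
  proof -
    have "v s \<bullet> w = 0" using Sph_inner[OF w s] by (simp add: inner_commute)
    moreover have "v s \<in> plane v p w" using v_in_Mp[OF s] Mp_subset_plane by blast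
    ultimately show ?thesis by (simp add: dir sum_delta_inner[OF s])
  qed
  have "w \<bullet> w = 1" using Sph_norm[OF w] by (simp add: dot_square_norm)
  then have dw: "dirderiv (CK mul v p m f) w y = CKs_normal w f y"
    using dir[OF Sph_in_plane] by (simp add: Sph_inner[OF w])
  \<comment> \<open>One more multiplication by \<open>w\<close> turns the Cauchy--Kovalevskaya
    equation into the monogenicity equation, because left multiplication by \<open>w\<close> squares
    to -1.\<close>
  have "CKs_normal w f y = mul w (\<Sum>s\<le>p. mul (v s) (CKs_tangential w f s y))"
    using reg[OF w y] by (simp add: CK_regular_def)
  then have "mul w (dirderiv (CK mul v p m f) w y) = - (\<Sum>s\<le>p. mul (v s) (CKs_tangential w f s y))"
    unfolding dw by (simp add: Sph_square[OF w])
  moreover have "Dxp mul v p (CK mul v p m f) y = (\<Sum>s\<le>p. mul (v s) (CKs_tangential w f s y))"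
    unfolding Dxp_def by (intro sum.cong refl) (simp add: dv)
  ultimately show "Dxp mul v p (CK mul v p m f) y + mul w (dirderiv (CK mul v p m f) w y) = 0"
    by simp
qed

text \<open>Here x_q = 0: the even series reduces to its term with \<open>0 ^ 0\<close>, and the
  direction factor in front of the odd series is zero.\<close>

lemma CK_Mp: "y \<in> Mp v p \<Longrightarrow> CK mul v p m f y = f y"
proof -
  assume y: "y \<in> Mp v p"
  have "(\<Sum>k. CK_even v p m f y k) = (\<Sum>k\<in>{0}. CK_even v p m f y k)"
    by (rule suminf_finite) (auto simp: CK_even_def xqpart_Mp[OF y])
  then show ?thesis
    using y by (simp add: CK_def xqpart_Mp mul_simps CK_even_def negLap_pow_def xpart_Mp)
qed

end

theorem theorem3p3:
  fixes mul :: "'a::euclidean_space \<Rightarrow> 'a \<Rightarrow> 'a" and one :: 'a and cj :: "'a \<Rightarrow> 'a"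
    and v :: "nat \<Rightarrow> 'a" and m p :: nat
    and \<Omega>0 :: "'a set" and f0 :: "'a \<Rightarrow> 'a"
  assumes alg: "alt_algebra mul one cj"
    and dim: "DIM('a) > 1"
    and SA_ne: "SA mul one cj \<noteq> {}"
    and bas: "basis_setup mul one cj v m"
    and pm: "p < m"
    and dom: "domain_p v p \<Omega>0"
    and ana: "real_analytic_p v p \<Omega>0 f0"
  shows "\<exists>\<Omega>. slice_domain v p m \<Omega> \<and> p_symmetric v p m \<Omega> \<and>
           \<Omega> \<subseteq> cyl_ext v p m \<Omega>0 \<and> \<Omega>0 \<subseteq> \<Omega> \<and>
           (\<forall>x\<in>\<Omega>. summable (CK_even v p m f0 x) \<and> summable (CK_odd mul v p m f0 x)) \<and>
           gps_monogenic mul v p m \<Omega> (CK mul v p m f0) \<and>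
           (\<forall>x\<in>\<Omega>0. CK mul v p m f0 x = f0 x)"
proof -
  interpret slice_algebra mul one cj v m p
    using alg bas pm by unfold_locales
  have \<Omega>0: "\<Omega>0 \<noteq> {}" "\<Omega>0 \<subseteq> Mp v p" "openin (top_of_set (Mp v p)) \<Omega>0" "connected \<Omega>0"
    using dom by (auto simp: domain_p_def)
  have f0: "locally_majorized \<Omega>0 f0"
    unfolding locally_majorized_def using real_analytic_imp_majorized[OF ana _ \<Omega>0(2)] by metis
  \<comment> \<open>The radius at \<open>a\<close> meets two demands: regularity for all
    \<open>w\<close> at once, and a polydisc inside \<Omega>0, so that coefficients are evaluated
    only where the operator identities hold.\<close>
  have "\<exists>\<epsilon>>0. Mp v p \<inter> polydisc a \<epsilon> \<subseteq> \<Omega>0 \<and>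
      (\<forall>w\<in>Sph v p m. \<forall>x\<in>polydisc a \<epsilon>. \<bar>x \<bullet> w\<bar> < \<epsilon> \<longrightarrow> CK_regular w f0 x)" if a: "a \<in> \<Omega>0" for a
  proof -
    obtain \<rho> N where \<rho>: "0 < \<rho>" "majorized a \<rho> N f0"
      using f0 a by (rule locally_majorizedE)
    have "a \<in> Mp v p" using a \<Omega>0 by blast
    with \<rho> obtain \<epsilon>1 where \<epsilon>1: "0 < \<epsilon>1"
      "\<And>w x. w \<in> Sph v p m \<Longrightarrow> x \<in> polydisc a \<epsilon>1 \<Longrightarrow> \<bar>x \<bullet> w\<bar> < \<epsilon>1 \<Longrightarrow> CK_regular w f0 x"
      using CK_regular_near by metis
    obtain \<epsilon>2 where \<epsilon>2: "0 < \<epsilon>2" "Mp v p \<inter> polydisc a \<epsilon>2 \<subseteq> \<Omega>0"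
      using \<Omega>0(3) a by (rule polydisc_subset_open)
    have "polydisc a (min \<epsilon>1 \<epsilon>2) \<subseteq> polydisc a \<epsilon>1" "polydisc a (min \<epsilon>1 \<epsilon>2) \<subseteq> polydisc a \<epsilon>2"
      by (simp_all add: polydisc_mono)
    then show ?thesis
      using \<epsilon>1 \<epsilon>2 by (intro exI[of _ "min \<epsilon>1 \<epsilon>2"]) auto
  qed
  then obtain \<epsilon> where \<epsilon>: "\<And>a. a \<in> \<Omega>0 \<Longrightarrow> 0 < \<epsilon> a"
      "\<And>a. a \<in> \<Omega>0 \<Longrightarrow> Mp v p \<inter> polydisc a (\<epsilon> a) \<subseteq> \<Omega>0"
      "\<And>a w x. a \<in> \<Omega>0 \<Longrightarrow> w \<in> Sph v p m \<Longrightarrow> x \<in> polydisc a (\<epsilon> a) \<Longrightarrow> \<bar>x \<bullet> w\<bar> < \<epsilon> a \<Longrightarrow> CK_regular w f0 x"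
    by metis
  let ?\<Omega> = "CK_domain \<epsilon> \<Omega>0"
  \<comment> \<open>On the plane of \<open>w\<close> the norm of x_q is the absolute value of
    \<open>x \<bullet> w\<close>, so the bound in \<open>CK_domain\<close> is the one required by
    \<epsilon>.\<close>
  have reg: "CK_regular w f0 x" if w: "w \<in> Sph v p m" and x: "x \<in> slice v p ?\<Omega> w" for w x
    using x plane_decompose(2)[OF w, of x] \<epsilon>(3)[OF _ w] by (auto simp: slice_def CK_domain_def)
  have summ: "summable (CK_even v p m f0 x) \<and> summable (CK_odd mul v p m f0 x)" if x: "x \<in> ?\<Omega>" for x
  proof -
    obtain w where w: "w \<in> Sph v p m" "x \<in> plane v p w"
      using x Mspace_in_plane unfolding CK_domain_def by blast
    then have "CK_regular w f0 x" using reg x by (simp add: slice_def)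
    then show ?thesis
      using CK_eq_CKs(1,2)[OF f0 \<Omega>0(3) w xpart_CK_domain[OF \<epsilon>(2) x]] by blast
  qed
  obtain U where U: "open U" "?\<Omega> = Mspace v m \<inter> U" using CK_domain_open by blast
  have mono: "gps_monogenic mul v p m ?\<Omega> (CK mul v p m f0)"
    by (rule CK_monogenic[OF f0 \<Omega>0(3) U xpart_CK_domain[OF \<epsilon>(2)] reg])
  have "slice_domain v p m ?\<Omega>" by (rule slice_domain_CK_domain[OF \<Omega>0(2,4,1) \<epsilon>(1)])
  moreover have "?\<Omega> \<subseteq> cyl_ext v p m \<Omega>0" by (rule CK_domain_subset_cyl_ext[OF \<epsilon>(2)])
  moreover have "\<Omega>0 \<subseteq> ?\<Omega>" by (rule subset_CK_domain[OF \<Omega>0(2) \<epsilon>(1)])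
  moreover have "\<forall>x\<in>\<Omega>0. CK mul v p m f0 x = f0 x" using CK_Mp \<Omega>0(2) by blast
  moreover have "\<forall>x\<in>?\<Omega>. summable (CK_even v p m f0 x) \<and> summable (CK_odd mul v p m f0 x)"
    using summ by blast
  ultimately show ?thesis
    using p_symmetric_CK_domain[of \<epsilon> \<Omega>0] mono by (intro exI[of _ ?\<Omega>] conjI) assumption+
qed

end
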